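(* Let $\vartheta\in(0,\infty)$ and let $\mathcal{N}_{\vartheta^2}$ denote the centered Gaussian law on $\mathbb{R}$ with variance $\vartheta^2$. Then, as $J\to\infty$, $$F_{\mathcal{N}_{\vartheta^2}}(J)=\frac{\vartheta^2}{2J}+O\left(\frac{(\log J)^{1/2}}{J^2}\right).$$
   Context: Let $\mathbb{N}=\{1,2,\dots\}$. For a law $\mu$ on $\mathbb{R}$ with finite first moment, let $h=(h_n)_{n\in\mathbb{N}}$ be, under $\mathbb{P}_\mu$, an i.i.d. sequence of real random variables with law $\mu$. For $N\in\mathbb{N}$, $(a,b)\in\{-1,+1\}^2$ and real $J$, the partition function of the Ising chain with external field $h$ is $$Z_{N,h}^{a,b}(J):=\sum_{\substack{\sigma\in\{-1,1\}^{\{0,1,\dots,N\}}\\ \sigma_0=a,\ \sigma_N=b}}\exp\Big(-2J\sum_{n=1}^N\mathbf 1_{\{\sigma_n\ne\sigma_{n-1}\}}+\sum_{n=1}^N\sigma_nh_n\Big).$$ The free energy density $F_\mu(J)$ is the deterministic real number such that, $\mathbb{P}_\mu$-almost surely, for every $(a,b)\in\{-1,+1\}^2$, $\frac1N\log Z_{N,h}^{a,b}(J)\to F_\mu(J)$ as $N\to\infty$ (this limit exists by Kingman's subadditive ergodic theorem). *)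

theory Defs
  imports "HOL-Probability.Probability" "HOL-Library.Landau_Symbols"
begin

definition ising_Z :: "nat \<Rightarrow> (nat \<Rightarrow> real) \<Rightarrow> int \<Rightarrow> int \<Rightarrow> real \<Rightarrow> real" where
  "ising_Z N h a b J =
    (\<Sum>\<sigma> \<in> {\<sigma> \<in> {0..N} \<rightarrow>\<^sub>E {-1, 1 :: int}. \<sigma> 0 = a \<and> \<sigma> N = b}.
      exp (- 2 * J * (\<Sum>n=1..N. of_bool (\<sigma> n \<noteq> \<sigma> (n - 1)))
           + (\<Sum>n=1..N. of_int (\<sigma> n) * h n)))"

text \<open>The i.i.d. sequence \<open>(h n)\<close>, \<open>n \<ge> 1\<close>, is realised canonically as the coordinate
  sequence on the infinite product of copies of \<open>\<mu>\<close>.\<close>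

definition is_free_energy :: "real measure \<Rightarrow> real \<Rightarrow> real \<Rightarrow> bool" where
  "is_free_energy \<mu> J F \<longleftrightarrow>
    (AE h in (\<Pi>\<^sub>M n\<in>{1::nat..}. \<mu>).
      \<forall>a\<in>{-1, 1}. \<forall>b\<in>{-1, 1}. (\<lambda>N. ln (ising_Z N h a b J) / real N) \<longlonglongrightarrow> F)"

definition free_energy :: "real measure \<Rightarrow> real \<Rightarrow> real" where
  "free_energy \<mu> J = (THE F. is_free_energy \<mu> J F)"

text \<open>The second parameter of \<^const>\<open>normal_density\<close> is the standard deviation, whereas the
  argument here is the variance.\<close>

definition centered_gaussian :: "real \<Rightarrow> real measure" where
  "centered_gaussian v = density lborel (\<lambda>x. ennreal (normal_density 0 (sqrt v) x))"

end

theory Submission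
  imports Defs "HOL-Library.Discrete_Functions" "HOL-Real_Asymp.Real_Asymp"
begin

text \<open>
  Write \<open>l N\<close> for the logarithm of the ratio of the partition functions ending in \<open>+1\<close> and \<open>-1\<close>. The
  transfer matrix gives \<open>l (N + 1) = f (l N) + 2 * h (N + 1)\<close>, where \<open>f\<close> is a smoothed truncation to
  \<open>[-2J, 2J]\<close>, and the logarithm of the product of the two partition functions grows by \<open>g (l N)\<close>, where
  \<open>g\<close> is up to \<open>2 exp (-2J)\<close> the absolute value of the overshoot \<open>r l = l - f l\<close>.

  Since \<open>f\<close> is a strict contraction, the Poisson equation for \<open>g\<close> has a Lipschitz solution. It turns
  the sum of the \<open>g (l n)\<close> into a martingale plus a linear drift, so that half of the drift \<open>c\<close> is the
  free energy.

  To compute \<open>c\<close>, integrate \<open>l\<^sup>2 - (f l)\<^sup>2 = \<bar>r l\<bar> * (2 * \<bar>f l\<bar> + \<bar>r l\<bar>)\<close>. The left-hand side has mean four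
  times the variance of the noise up to a coboundary, and the right-hand side is \<open>4J * \<bar>r l\<bar>\<close> up to an
  error that is only felt near \<open>\<plusminus>2J\<close>. The time spent there is bounded by a multiple of the mean overshoot,
  as a convex test function shows. Coboundaries disappear on evaluating at an extremal point of the
  function they come from. The resulting error term is even \<open>O(1 / J\<^sup>2)\<close>.
\<close>

section \<open>A strong law for orthogonal random variables\<close>

definition L2_bounded :: "'a measure \<Rightarrow> ('i \<Rightarrow> 'a \<Rightarrow> real) \<Rightarrow> bool" where
  "L2_bounded M X \<longleftrightarrow> (\<exists>C. \<forall>i. X i \<in> borel_measurable M \<and> integrable M (\<lambda>x. (X i x)\<^sup>2)
     \<and> (\<integral>x. (X i x)\<^sup>2 \<partial>M) \<le> C)"

lemma L2_boundedI:
  assumes "\<And>i. X i \<in> borel_measurable M" "\<And>i. integrable M (\<lambda>x. (X i x)\<^sup>2)"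
    and "\<And>i. (\<integral>x. (X i x)\<^sup>2 \<partial>M) \<le> C"
  shows "L2_bounded M X"
  using assms unfolding L2_bounded_def by blast

lemma L2_boundedE:
  assumes "L2_bounded M X"
  obtains C where "\<And>i. X i \<in> borel_measurable M" "\<And>i. integrable M (\<lambda>x. (X i x)\<^sup>2)"
    "\<And>i. (\<integral>x. (X i x)\<^sup>2 \<partial>M) \<le> C" "0 \<le> C"
proof -
  obtain C where bounded: "\<And>i. X i \<in> borel_measurable M \<and> integrable M (\<lambda>x. (X i x)\<^sup>2)
      \<and> (\<integral>x. (X i x)\<^sup>2 \<partial>M) \<le> C"
    using assms unfolding L2_bounded_def by blast
  have "0 \<le> (\<integral>x. (X undefined x)\<^sup>2 \<partial>M)" by simp
  also have "\<dots> \<le> C" using bounded by blast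
  finally show thesis using that bounded by blast
qed

lemma L2_bounded_dominated:
  assumes "L2_bounded M Y" and X_meas: "\<And>i. X i \<in> borel_measurable M"
    and dominated: "\<And>i x. x \<in> space M \<Longrightarrow> \<bar>X i x\<bar> \<le> \<bar>Y i x\<bar>"
  shows "L2_bounded M X"
proof -
  obtain C where Y_square: "\<And>i. integrable M (\<lambda>x. (Y i x)\<^sup>2)" "\<And>i. (\<integral>x. (Y i x)\<^sup>2 \<partial>M) \<le> C"
    using assms(1) by (rule L2_boundedE) blast
  have square_le: "(X i x)\<^sup>2 \<le> (Y i x)\<^sup>2" if "x \<in> space M" for i x
    using dominated[OF that] by (simp add: abs_le_square_iff)
  have X_square: "integrable M (\<lambda>x. (X i x)\<^sup>2)" for i
    by (rule Bochner_Integration.integrable_bound[OF Y_square(1)]) (use X_meas square_le in auto)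
  show ?thesis
    using X_meas X_square Y_square square_le
    by (intro L2_boundedI[where C = C] order_trans[OF integral_mono Y_square(2)])
qed

lemma L2_bounded_reindex: "L2_bounded M X \<Longrightarrow> L2_bounded M (\<lambda>i. X (f i))"
  unfolding L2_bounded_def by blast

lemma L2_bounded_cmult:
  assumes "L2_bounded M X"
  shows "L2_bounded M (\<lambda>i x. c * X i x)"
proof -
  obtain C where "\<And>i. X i \<in> borel_measurable M" "\<And>i. integrable M (\<lambda>x. (X i x)\<^sup>2)"
    "\<And>i. (\<integral>x. (X i x)\<^sup>2 \<partial>M) \<le> C"
    using assms by (rule L2_boundedE) blast
  then show ?thesis
    by (intro L2_boundedI[where C = "c\<^sup>2 * C"]) (auto simp: power_mult_distrib intro: mult_left_mono)
qed

lemma L2_bounded_add: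
  assumes "L2_bounded M X" "L2_bounded M Y"
  shows "L2_bounded M (\<lambda>i x. X i x + Y i x)"
proof -
  obtain C where [measurable]: "\<And>i. X i \<in> borel_measurable M"
    and X_square: "\<And>i. integrable M (\<lambda>x. (X i x)\<^sup>2)" "\<And>i. (\<integral>x. (X i x)\<^sup>2 \<partial>M) \<le> C"
    using assms(1) by (rule L2_boundedE) blast
  obtain D where [measurable]: "\<And>i. Y i \<in> borel_measurable M"
    and Y_square: "\<And>i. integrable M (\<lambda>x. (Y i x)\<^sup>2)" "\<And>i. (\<integral>x. (Y i x)\<^sup>2 \<partial>M) \<le> D"
    using assms(2) by (rule L2_boundedE) blast
  have square_le: "(X i x + Y i x)\<^sup>2 \<le> 2 * (X i x)\<^sup>2 + 2 * (Y i x)\<^sup>2" for i x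
    using sum_squares_bound[of "X i x" "Y i x"] by (simp add: power2_sum)
  have dominating: "integrable M (\<lambda>x. 2 * (X i x)\<^sup>2 + 2 * (Y i x)\<^sup>2)" for i
    using X_square Y_square by simp
  have square: "integrable M (\<lambda>x. (X i x + Y i x)\<^sup>2)" for i
    by (rule Bochner_Integration.integrable_bound[OF dominating]) (use square_le in auto)
  show ?thesis
  proof (rule L2_boundedI[OF _ square])
    fix i
    have "(\<integral>x. (X i x + Y i x)\<^sup>2 \<partial>M) \<le> (\<integral>x. 2 * (X i x)\<^sup>2 + 2 * (Y i x)\<^sup>2 \<partial>M)"
      by (rule integral_mono[OF square dominating square_le])
    also have "\<dots> \<le> 2 * C + 2 * D"
      using X_square[of i] Y_square[of i] by simp
    finally show "(\<integral>x. (X i x + Y i x)\<^sup>2 \<partial>M) \<le> 2 * C + 2 * D" .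
  qed measurable
qed

lemma (in finite_measure) L2_bounded_const: "L2_bounded M (\<lambda>i x. c)"
  by (rule L2_boundedI) auto

lemma integrable_mult_if_squares_integrable:
  fixes f g :: "'a \<Rightarrow> real"
  assumes [measurable]: "f \<in> borel_measurable M" "g \<in> borel_measurable M"
    and "integrable M (\<lambda>x. (f x)\<^sup>2)" "integrable M (\<lambda>x. (g x)\<^sup>2)"
  shows "integrable M (\<lambda>x. f x * g x)"
proof (rule Bochner_Integration.integrable_bound[of _ "\<lambda>x. (f x)\<^sup>2 + (g x)\<^sup>2"])
  have "\<bar>f x * g x\<bar> \<le> (f x)\<^sup>2 + (g x)\<^sup>2" for x
    using sum_squares_bound[of "\<bar>f x\<bar>" "\<bar>g x\<bar>"] abs_ge_zero[of "f x * g x"]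
    unfolding abs_mult power2_abs by linarith
  then show "AE x in M. norm (f x * g x) \<le> norm ((f x)\<^sup>2 + (g x)\<^sup>2)" by simp
qed (use assms in auto)

lemma
  fixes X :: "'i \<Rightarrow> 'a \<Rightarrow> real"
  assumes "finite I" and meas: "\<And>i. X i \<in> borel_measurable M"
    and square: "\<And>i. integrable M (\<lambda>x. (X i x)\<^sup>2)"
  shows integrable_square_sum: "integrable M (\<lambda>x. (\<Sum>i\<in>I. X i x)\<^sup>2)"
    and integral_square_sum_orthogonal: "\<lbrakk>\<And>i j. i \<noteq> j \<Longrightarrow> (\<integral>x. X i x * X j x \<partial>M) = 0\<rbrakk>
      \<Longrightarrow> (\<integral>x. (\<Sum>i\<in>I. X i x)\<^sup>2 \<partial>M) = (\<Sum>i\<in>I. \<integral>x. (X i x)\<^sup>2 \<partial>M)"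
proof -
  have product: "integrable M (\<lambda>x. X i x * X j x)" for i j
    by (rule integrable_mult_if_squares_integrable[OF meas meas square square])
  have square_sum: "(\<Sum>i\<in>I. X i x)\<^sup>2 = (\<Sum>i\<in>I. \<Sum>j\<in>I. X i x * X j x)" for x
    by (simp add: power2_eq_square sum_product)
  show "integrable M (\<lambda>x. (\<Sum>i\<in>I. X i x)\<^sup>2)"
    using product by (simp add: square_sum)
  assume orthogonal: "\<And>i j. i \<noteq> j \<Longrightarrow> (\<integral>x. X i x * X j x \<partial>M) = 0"
  have "(\<integral>x. (\<Sum>i\<in>I. X i x)\<^sup>2 \<partial>M) = (\<Sum>i\<in>I. \<Sum>j\<in>I. \<integral>x. X i x * X j x \<partial>M)"
    using product by (simp add: square_sum)
  also have "\<dots> = (\<Sum>i\<in>I. \<Sum>j\<in>I. if j = i then \<integral>x. (X i x)\<^sup>2 \<partial>M else 0)"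
    using orthogonal by (intro sum.cong) (auto simp: power2_eq_square)
  finally show "(\<integral>x. (\<Sum>i\<in>I. X i x)\<^sup>2 \<partial>M) = (\<Sum>i\<in>I. \<integral>x. (X i x)\<^sup>2 \<partial>M)"
    using \<open>finite I\<close> by simp
qed

lemma integral_square_sum_le:
  fixes X :: "'i \<Rightarrow> 'a \<Rightarrow> real"
  assumes "finite I" "\<And>i. X i \<in> borel_measurable M" and square: "\<And>i. integrable M (\<lambda>x. (X i x)\<^sup>2)"
  shows "(\<integral>x. (\<Sum>i\<in>I. X i x)\<^sup>2 \<partial>M) \<le> real (card I) * (\<Sum>i\<in>I. \<integral>x. (X i x)\<^sup>2 \<partial>M)"
proof -
  have "(\<integral>x. (\<Sum>i\<in>I. X i x)\<^sup>2 \<partial>M) \<le> (\<integral>x. (\<Sum>i\<in>I. (X i x)\<^sup>2) * real (card I) \<partial>M)"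
    using assms by (intro integral_mono integrable_square_sum sum_squared_le_sum_of_squares) auto
  then show ?thesis using square by (simp add: mult.commute)
qed

lemma AE_tendsto_0_if_summable_second_moments:
  fixes X :: "nat \<Rightarrow> 'a \<Rightarrow> real"
  assumes square: "\<And>n. integrable M (\<lambda>x. (X n x)\<^sup>2)"
    and bound: "\<And>n. (\<integral>x. (X n x)\<^sup>2 \<partial>M) \<le> B n" and "summable B"
  shows "AE x in M. (\<lambda>n. X n x) \<longlonglongrightarrow> 0"
proof -
  have [measurable]: "(\<lambda>x. (X n x)\<^sup>2) \<in> borel_measurable M" for n
    using square by (rule borel_measurable_integrable)
  have nonneg: "0 \<le> (\<integral>x. (X n x)\<^sup>2 \<partial>M)" for n by simp
  have "summable (\<lambda>n. \<integral>x. (X n x)\<^sup>2 \<partial>M)"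
    using bound nonneg by (intro summable_comparison_test[OF _ \<open>summable B\<close>]) auto
  then have "(\<Sum>n. ennreal (\<integral>x. (X n x)\<^sup>2 \<partial>M)) \<noteq> \<infinity>"
    using suminf_ennreal2[OF nonneg] by simp
  moreover have "(\<integral>\<^sup>+x. (\<Sum>n. ennreal ((X n x)\<^sup>2)) \<partial>M) = (\<Sum>n. ennreal (\<integral>x. (X n x)\<^sup>2 \<partial>M))"
    by (subst nn_integral_suminf) (auto simp: nn_integral_eq_integral[OF square])
  ultimately have "AE x in M. (\<Sum>n. ennreal ((X n x)\<^sup>2)) \<noteq> \<infinity>"
    by (intro nn_integral_PInf_AE) auto
  then show ?thesis
  proof eventually_elim
    case (elim x)
    then have "summable (\<lambda>n. (X n x)\<^sup>2)" by (intro summable_suminf_not_top) auto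
    then have "(\<lambda>n. sqrt ((X n x)\<^sup>2)) \<longlonglongrightarrow> sqrt 0"
      by (intro tendsto_real_sqrt summable_LIMSEQ_zero)
    then show ?case by (simp add: tendsto_rabs_zero_iff)
  qed
qed

lemma AE_L2_bounded_div_tendsto_0:
  assumes "L2_bounded M X"
  shows "AE x in M. (\<lambda>n. X n x / real n) \<longlonglongrightarrow> 0"
proof -
  obtain C where square: "\<And>n. integrable M (\<lambda>x. (X n x)\<^sup>2)" "\<And>n. (\<integral>x. (X n x)\<^sup>2 \<partial>M) \<le> C"
    using assms by (rule L2_boundedE) blast
  show ?thesis
  proof (rule AE_tendsto_0_if_summable_second_moments)
    show "integrable M (\<lambda>x. (X n x / real n)\<^sup>2)" for n
      using square(1) by (simp add: power_divide)
    show "(\<integral>x. (X n x / real n)\<^sup>2 \<partial>M) \<le> C * inverse (real n ^ 2)" for n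
      using divide_right_mono[OF square(2)[of n], of "real n ^ 2"]
      by (simp add: power_divide) (simp add: divide_inverse)
  qed (intro summable_mult inverse_power_summable order_refl)
qed

lemma averages_tendsto_0_if_along_squares:
  fixes d :: "nat \<Rightarrow> real"
  assumes squares: "(\<lambda>m. (\<Sum>k<m\<^sup>2. d k) / real (m\<^sup>2)) \<longlonglongrightarrow> 0"
    and blocks: "(\<lambda>m. (\<Sum>k=m\<^sup>2..<(Suc m)\<^sup>2. \<bar>d k\<bar>) / real (m\<^sup>2)) \<longlonglongrightarrow> 0"
  shows "(\<lambda>N. (\<Sum>k<N. d k) / real N) \<longlonglongrightarrow> 0"
proof -
  define b where "b m = \<bar>(\<Sum>k<m\<^sup>2. d k) / real (m\<^sup>2)\<bar> + (\<Sum>k=m\<^sup>2..<(Suc m)\<^sup>2. \<bar>d k\<bar>) / real (m\<^sup>2)" for m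
  have "filterlim floor_sqrt at_top sequentially"
    unfolding filterlim_at_top
  proof
    fix Z
    show "\<forall>\<^sub>F n in sequentially. Z \<le> floor_sqrt n"
      using eventually_ge_at_top[of "Z\<^sup>2"] by eventually_elim (rule le_floor_sqrtI)
  qed
  moreover have "b \<longlonglongrightarrow> 0"
    unfolding b_def using tendsto_add[OF tendsto_rabs[OF squares] blocks] by simp
  ultimately have b_lim: "(\<lambda>N. b (floor_sqrt N)) \<longlonglongrightarrow> 0"
    by (rule filterlim_compose[rotated])
  have average_le: "\<bar>(\<Sum>k<N. d k) / real N\<bar> \<le> b (floor_sqrt N)" if "0 < N" for N
  proof -
    define m where "m = floor_sqrt N"
    have m_bounds: "0 < m" "m\<^sup>2 \<le> N" "N \<le> (Suc m)\<^sup>2"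
      using that Suc_floor_sqrt_power2_gt[of N] by (simp_all add: m_def less_imp_le)
    have "(\<Sum>k<N. d k) = (\<Sum>k<m\<^sup>2. d k) + (\<Sum>k=m\<^sup>2..<N. d k)"
      using m_bounds(2) by (simp add: sum.atLeastLessThan_concat atLeast0LessThan[symmetric])
    also have "\<bar>\<dots>\<bar> \<le> \<bar>\<Sum>k<m\<^sup>2. d k\<bar> + (\<Sum>k=m\<^sup>2..<N. \<bar>d k\<bar>)"
      by (intro order_trans[OF abs_triangle_ineq] add_left_mono sum_abs)
    also have "(\<Sum>k=m\<^sup>2..<N. \<bar>d k\<bar>) \<le> (\<Sum>k=m\<^sup>2..<(Suc m)\<^sup>2. \<bar>d k\<bar>)"
      using m_bounds(3) by (intro sum_mono2) auto
    finally have "\<bar>\<Sum>k<N. d k\<bar> / real N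
        \<le> (\<bar>\<Sum>k<m\<^sup>2. d k\<bar> + (\<Sum>k=m\<^sup>2..<(Suc m)\<^sup>2. \<bar>d k\<bar>)) / real (m\<^sup>2)"
      using m_bounds by (intro frac_le) (auto intro: add_nonneg_nonneg sum_nonneg)
    then show ?thesis
      by (simp add: b_def m_def abs_divide add_divide_distrib)
  qed
  show ?thesis
    by (rule Lim_null_comparison[OF _ b_lim])
      (use eventually_gt_at_top[of 0] in eventually_elim, use average_le in simp)
qed

lemma AE_div_square_tendsto_0:
  fixes S :: "nat \<Rightarrow> 'a \<Rightarrow> real"
  assumes square: "\<And>m. integrable M (\<lambda>x. (S m x)\<^sup>2)"
    and bound: "\<And>m. (\<integral>x. (S m x)\<^sup>2 \<partial>M) \<le> C * (real (Suc m))\<^sup>2"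
  shows "AE x in M. (\<lambda>m. S m x / real (m\<^sup>2)) \<longlonglongrightarrow> 0"
proof (rule AE_tendsto_0_if_summable_second_moments)
  have "0 \<le> (\<integral>x. (S 0 x)\<^sup>2 \<partial>M)" by simp
  also have "\<dots> \<le> C" using bound[of 0] by simp
  finally have "0 \<le> C" .
  fix m :: nat
  show "integrable M (\<lambda>x. (S m x / real (m\<^sup>2))\<^sup>2)"
    using square by (simp add: power_divide)
  have "(\<integral>x. (S m x / real (m\<^sup>2))\<^sup>2 \<partial>M) \<le> C * (real (Suc m))\<^sup>2 / (real (m\<^sup>2))\<^sup>2"
    unfolding power_divide by (simp add: divide_right_mono bound del: of_nat_Suc)
  also have "\<dots> \<le> C * (2 * real m)\<^sup>2 / (real (m\<^sup>2))\<^sup>2"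
  proof (cases "m = 0")
    case False
    then show ?thesis
      using \<open>0 \<le> C\<close> by (intro divide_right_mono mult_left_mono power_mono) simp_all
  qed simp
  also have "\<dots> = 4 * C * inverse (real m ^ 2)"
    by (simp add: power2_eq_square field_simps)
  finally show "(\<integral>x. (S m x / real (m\<^sup>2))\<^sup>2 \<partial>M) \<le> 4 * C * inverse (real m ^ 2)" .
qed (intro summable_mult inverse_power_summable order_refl)

lemma AE_orthogonal_averages_along_squares_tendsto_0:
  fixes D :: "nat \<Rightarrow> 'a \<Rightarrow> real"
  assumes "L2_bounded M D" and orthogonal: "\<And>m n. m \<noteq> n \<Longrightarrow> (\<integral>x. D m x * D n x \<partial>M) = 0"
  shows "AE x in M. (\<lambda>m. (\<Sum>k<m\<^sup>2. D k x) / real (m\<^sup>2)) \<longlonglongrightarrow> 0"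
proof -
  obtain C where meas: "\<And>k. D k \<in> borel_measurable M" and square: "\<And>k. integrable M (\<lambda>x. (D k x)\<^sup>2)"
    and square_le: "\<And>k. (\<integral>x. (D k x)\<^sup>2 \<partial>M) \<le> C" and "0 \<le> C"
    using assms(1) by (rule L2_boundedE) blast
  show ?thesis
  proof (rule AE_div_square_tendsto_0)
    fix m :: nat
    show "integrable M (\<lambda>x. (\<Sum>k<m\<^sup>2. D k x)\<^sup>2)"
      using meas square by (simp add: integrable_square_sum)
    have "(\<integral>x. (\<Sum>k<m\<^sup>2. D k x)\<^sup>2 \<partial>M) = (\<Sum>k<m\<^sup>2. \<integral>x. (D k x)\<^sup>2 \<partial>M)"
      using meas square orthogonal by (simp add: integral_square_sum_orthogonal)
    also have "\<dots> \<le> C * (real m)\<^sup>2"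
      using sum_bounded_above[of "{..<m\<^sup>2}" _ C] square_le by (simp add: mult.commute)
    also have "\<dots> \<le> C * (real (Suc m))\<^sup>2"
      using \<open>0 \<le> C\<close> by (intro mult_left_mono power_mono) auto
    finally show "(\<integral>x. (\<Sum>k<m\<^sup>2. D k x)\<^sup>2 \<partial>M) \<le> C * (real (Suc m))\<^sup>2" .
  qed
qed

lemma AE_block_sums_between_squares_tendsto_0:
  fixes D :: "nat \<Rightarrow> 'a \<Rightarrow> real"
  assumes "L2_bounded M D"
  shows "AE x in M. (\<lambda>m. (\<Sum>k=m\<^sup>2..<(Suc m)\<^sup>2. \<bar>D k x\<bar>) / real (m\<^sup>2)) \<longlonglongrightarrow> 0"
proof -
  obtain C where meas: "\<And>k. D k \<in> borel_measurable M" and square: "\<And>k. integrable M (\<lambda>x. (D k x)\<^sup>2)"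
    and square_le: "\<And>k. (\<integral>x. (D k x)\<^sup>2 \<partial>M) \<le> C" and "0 \<le> C"
    using assms by (rule L2_boundedE) blast
  show ?thesis
  proof (rule AE_div_square_tendsto_0)
    fix m :: nat
    let ?I = "{m\<^sup>2..<(Suc m)\<^sup>2}"
    show "integrable M (\<lambda>x. (\<Sum>k\<in>?I. \<bar>D k x\<bar>)\<^sup>2)"
      using meas square by (intro integrable_square_sum) auto
    have "(\<integral>x. (\<Sum>k\<in>?I. \<bar>D k x\<bar>)\<^sup>2 \<partial>M) \<le> real (card ?I) * (\<Sum>k\<in>?I. \<integral>x. (D k x)\<^sup>2 \<partial>M)"
      using integral_square_sum_le[of ?I "\<lambda>k x. \<bar>D k x\<bar>" M] meas square by simp
    also have "\<dots> \<le> real (card ?I) * (real (card ?I) * C)"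
      by (intro mult_left_mono sum_bounded_above square_le) simp
    also have "\<dots> = C * (real (card ?I))\<^sup>2"
      by (simp add: power2_eq_square)
    also have "card ?I = 2 * m + 1"
      by (simp add: power2_eq_square)
    also have "C * (real (2 * m + 1))\<^sup>2 \<le> C * (2 * real (Suc m))\<^sup>2"
      using \<open>0 \<le> C\<close> by (intro mult_left_mono power_mono) auto
    finally show "(\<integral>x. (\<Sum>k\<in>?I. \<bar>D k x\<bar>)\<^sup>2 \<partial>M) \<le> 4 * C * (real (Suc m))\<^sup>2"
      by (simp only: power_mult_distrib) simp
  qed
qed

theorem AE_orthogonal_averages_tendsto_0:
  fixes D :: "nat \<Rightarrow> 'a \<Rightarrow> real"
  assumes "L2_bounded M D" and "\<And>m n. m \<noteq> n \<Longrightarrow> (\<integral>x. D m x * D n x \<partial>M) = 0"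
  shows "AE x in M. (\<lambda>N. (\<Sum>k<N. D k x) / real N) \<longlonglongrightarrow> 0"
proof -
  have "AE x in M. (\<lambda>m. (\<Sum>k<m\<^sup>2. D k x) / real (m\<^sup>2)) \<longlonglongrightarrow> 0"
    using assms by (rule AE_orthogonal_averages_along_squares_tendsto_0)
  with AE_block_sums_between_squares_tendsto_0[OF assms(1)] show ?thesis
    by eventually_elim (rule averages_tendsto_0_if_along_squares)
qed

lemma integral_PiM_fun_upd:
  fixes F :: "('i \<Rightarrow> 'a) \<Rightarrow> real"
  assumes prob: "\<And>i. prob_space (M i)" and "i \<in> I" and F_integrable: "integrable (PiM I M) F"
  shows "(\<integral>X. F X \<partial>PiM I M) = (\<integral>X. (\<integral>x. F (X(i := x)) \<partial>M i) \<partial>PiM (I - {i}) M)"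
proof -
  define R where "R = PiM (I - {i}) M"
  interpret R: prob_space R unfolding R_def by (rule prob_space_PiM) (rule prob)
  interpret Mi: prob_space "M i" by (rule prob)
  interpret pair_sigma_finite "M i" R ..
  have insert_i: "insert i (I - {i}) = I" using \<open>i \<in> I\<close> by auto
  have distr: "distr (M i \<Otimes>\<^sub>M R) (PiM I M) (\<lambda>(x, X). X(i := x)) = PiM I M"
    using distr_pair_PiM_eq_PiM[of "I - {i}" M i] prob unfolding R_def insert_i by simp
  have update_meas: "(\<lambda>(x, X). X(i := x)) \<in> measurable (M i \<Otimes>\<^sub>M R) (PiM I M)"
    using measurable_add_dim[of i "I - {i}" M] unfolding R_def insert_i
    by (subst measurable_pair_swap_iff) (simp add: case_prod_unfold)
  note F_meas = borel_measurable_integrable[OF F_integrable]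
  have pair_integrable: "integrable (M i \<Otimes>\<^sub>M R) (\<lambda>(x, X). F (X(i := x)))"
    using integrable_distr_eq[OF update_meas F_meas] F_integrable unfolding distr by (simp add: case_prod_unfold)
  have "(\<integral>X. F X \<partial>PiM I M) = integral\<^sup>L (M i \<Otimes>\<^sub>M R) (\<lambda>(x, X). F (X(i := x)))"
    using integral_distr[OF update_meas F_meas] unfolding distr by (simp add: case_prod_unfold)
  also have "\<dots> = (\<integral>X. (\<integral>x. F (X(i := x)) \<partial>M i) \<partial>R)"
    by (rule integral_snd[OF pair_integrable, symmetric])
  finally show ?thesis by (simp add: R_def)
qed

section \<open>Contracting random maps\<close>

definition iid_sequences :: "'t measure \<Rightarrow> (nat \<Rightarrow> 't) measure" where
  "iid_sequences \<mu> = (\<Pi>\<^sub>M n\<in>{1..}. \<mu>)"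

context prob_space
begin

lemma prob_space_iid_sequences: "prob_space (iid_sequences M)"
  unfolding iid_sequences_def by (rule prob_space_PiM) (rule prob_space_axioms)

lemma measurable_iid_component [measurable]: "(\<lambda>h. h (Suc n)) \<in> iid_sequences M \<rightarrow>\<^sub>M M"
  unfolding iid_sequences_def by (rule measurable_component_singleton) simp

lemma distr_iid_component: "distr (iid_sequences M) M (\<lambda>h. h (Suc n)) = M"
  unfolding iid_sequences_def by (rule distr_PiM_component) (simp_all add: prob_space_axioms)

lemma
  fixes \<psi> :: "'a \<Rightarrow> real"
  assumes "\<psi> \<in> borel_measurable M"
  shows integrable_iid_component_iff:
      "integrable (iid_sequences M) (\<lambda>h. \<psi> (h (Suc n))) \<longleftrightarrow> integrable M \<psi>"
    and integral_iid_component: "(\<integral>h. \<psi> (h (Suc n)) \<partial>iid_sequences M) = (\<integral>t. \<psi> t \<partial>M)"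
  using integrable_distr_eq[OF measurable_iid_component assms, of n]
    integral_distr[OF measurable_iid_component assms, of n]
  by (simp_all add: distr_iid_component)

lemma L2_bounded_iid:
  fixes \<psi> :: "'a \<Rightarrow> real"
  assumes "\<psi> \<in> borel_measurable M" "integrable M (\<lambda>t. (\<psi> t)\<^sup>2)"
  shows "L2_bounded (iid_sequences M) (\<lambda>n h. \<psi> (h (Suc n)))"
  using assms
  by (intro L2_boundedI[where C = "\<integral>t. (\<psi> t)\<^sup>2 \<partial>M"])
    (auto simp: integrable_iid_component_iff[of "\<lambda>t. (\<psi> t)\<^sup>2"] integral_iid_component[of "\<lambda>t. (\<psi> t)\<^sup>2"])

lemma lipschitz_integral:
  fixes g :: "'a \<Rightarrow> 'b::metric_space \<Rightarrow> real"
  assumes lip: "\<And>t. L-lipschitz_on UNIV (g t)" and integrable: "\<And>x. integrable M (\<lambda>t. g t x)"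
  shows "L-lipschitz_on UNIV (\<lambda>x. \<integral>t. g t x \<partial>M)"
proof (rule lipschitz_onI)
  fix x y
  have "\<bar>(\<integral>t. g t x \<partial>M) - (\<integral>t. g t y \<partial>M)\<bar> \<le> (\<integral>t. \<bar>g t x - g t y\<bar> \<partial>M)"
    using integral_abs_bound[of M "\<lambda>t. g t x - g t y"] by (simp add: integrable)
  also have "\<dots> \<le> (\<integral>t. L * dist x y \<partial>M)"
    using lipschitz_onD[OF lip] by (intro integral_mono) (auto simp: integrable dist_real_def)
  finally show "dist (\<integral>t. g t x \<partial>M) (\<integral>t. g t y \<partial>M) \<le> L * dist x y"
    by (simp add: dist_real_def prob_space)
qed (rule lipschitz_on_nonneg[OF lip])

end

lemma borel_measurable_dist_const [measurable (raw)]: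
  fixes f :: "'a \<Rightarrow> 'b::metric_space"
  shows "f \<in> borel_measurable M \<Longrightarrow> (\<lambda>x. dist (f x) y) \<in> borel_measurable M"
  by (rule borel_measurable_continuous_on) (intro continuous_intros)

lemma lipschitz_on_UNIV_borel_measurable:
  fixes \<phi> :: "'a::metric_space \<Rightarrow> real"
  shows "L-lipschitz_on UNIV \<phi> \<Longrightarrow> \<phi> \<in> borel_measurable borel"
  by (intro borel_measurable_continuous_onI lipschitz_on_continuous_on)

lemma lipschitz_on_UNIV_abs_le:
  fixes \<phi> :: "'a::metric_space \<Rightarrow> real"
  assumes "L-lipschitz_on UNIV \<phi>"
  shows "\<bar>\<phi> x\<bar> \<le> \<bar>\<phi> y\<bar> + L * dist x y"
  using lipschitz_onD[OF assms, of x y] by (simp add: dist_real_def)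

primrec orbit :: "('t \<Rightarrow> 'a \<Rightarrow> 'a) \<Rightarrow> (nat \<Rightarrow> 't) \<Rightarrow> 'a \<Rightarrow> nat \<Rightarrow> 'a" where
  "orbit F h x 0 = x"
| "orbit F h x (Suc n) = F (h (Suc n)) (orbit F h x n)"

lemma orbit_fun_upd: "n < i \<Longrightarrow> orbit F (h(i := t)) x n = orbit F h x n"
  by (induction n) auto

locale contracting_random_map = prob_space \<mu> for \<mu> :: "'t measure" +
  fixes F :: "'t \<Rightarrow> 'a::metric_space \<Rightarrow> 'a" and \<kappa> :: real and z :: 'a
  assumes measurable_map: "(\<lambda>(t, x). F t x) \<in> borel_measurable (\<mu> \<Otimes>\<^sub>M borel)"
    and lipschitz_map: "\<And>t. \<kappa>-lipschitz_on UNIV (F t)"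
    and rate_less_1: "\<kappa> < 1"
    and square_integrable_displacement: "integrable \<mu> (\<lambda>t. (dist (F t z) z)\<^sup>2)"
begin

definition transition :: "('a \<Rightarrow> real) \<Rightarrow> 'a \<Rightarrow> real" where
  "transition \<phi> x = (\<integral>t. \<phi> (F t x) \<partial>\<mu>)"

lemma rate_nonneg: "0 \<le> \<kappa>"
  using lipschitz_map by (rule lipschitz_on_nonneg)

lemma borel_measurable_map [measurable]: "(\<lambda>t. F t x) \<in> borel_measurable \<mu>"
  using measurable_compose[OF measurable_Pair2'[of x borel \<mu>] measurable_map] by simp

lemma dist_map_le: "dist (F t x) z \<le> \<kappa> * dist x z + dist (F t z) z"
  using lipschitz_onD[OF lipschitz_map, of x z t] dist_triangle[of "F t x" z "F t z"] by simp

lemma integrable_dist_map: "integrable \<mu> (\<lambda>t. dist (F t x) z)"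
proof (rule Bochner_Integration.integrable_bound)
  have "integrable \<mu> (\<lambda>t. dist (F t z) z)"
    by (rule square_integrable_imp_integrable[OF _ square_integrable_displacement]) measurable
  then show "integrable \<mu> (\<lambda>t. \<kappa> * dist x z + dist (F t z) z)" by simp
  show "AE t in \<mu>. norm (dist (F t x) z) \<le> norm (\<kappa> * dist x z + dist (F t z) z)"
    using dist_map_le rate_nonneg by (intro AE_I2) simp
qed measurable

lemma integrable_lipschitz:
  fixes \<phi> :: "'a \<Rightarrow> real"
  assumes "L-lipschitz_on UNIV \<phi>"
  shows "integrable \<mu> (\<lambda>t. \<phi> (F t x))"
proof (rule Bochner_Integration.integrable_bound)
  show "integrable \<mu> (\<lambda>t. \<bar>\<phi> z\<bar> + L * dist (F t x) z)"
    using integrable_dist_map by simp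
  show "(\<lambda>t. \<phi> (F t x)) \<in> borel_measurable \<mu>"
    using lipschitz_on_UNIV_borel_measurable[OF assms] by measurable
  show "AE t in \<mu>. norm (\<phi> (F t x)) \<le> norm (\<bar>\<phi> z\<bar> + L * dist (F t x) z)"
    using lipschitz_on_UNIV_abs_le[OF assms] by (intro AE_I2) (simp add: order_trans[OF _ abs_ge_self])
qed

lemma lipschitz_transition:
  assumes "L-lipschitz_on UNIV \<phi>"
  shows "(L * \<kappa>)-lipschitz_on UNIV (transition \<phi>)"
  unfolding transition_def [abs_def]
proof (intro lipschitz_integral integrable_lipschitz[OF assms])
  show "(L * \<kappa>)-lipschitz_on UNIV (\<lambda>x. \<phi> (F t x))" for t
    by (rule lipschitz_on_compose2[OF lipschitz_map lipschitz_on_subset[OF assms]]) simp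
qed

lemma lipschitz_transition_funpow:
  assumes "L-lipschitz_on UNIV \<phi>"
  shows "(L * \<kappa> ^ n)-lipschitz_on UNIV ((transition ^^ n) \<phi>)"
proof (induction n)
  case (Suc n)
  then show ?case using lipschitz_transition[OF Suc] by (simp add: mult_ac)
qed (simp add: assms)

text \<open>The solution of the Poisson equation is the limit of the partial sums of the transition iterates,
  recentred at \<open>z\<close>.\<close>

definition corrector :: "('a \<Rightarrow> real) \<Rightarrow> nat \<Rightarrow> 'a \<Rightarrow> real" where
  "corrector \<phi> N x = (\<Sum>n<N. (transition ^^ n) \<phi> x - (transition ^^ n) \<phi> z)"

lemma abs_transition_funpow_diff_le:
  assumes "L-lipschitz_on UNIV \<phi>"
  shows "\<bar>(transition ^^ n) \<phi> x - (transition ^^ n) \<phi> y\<bar> \<le> L * dist x y * \<kappa> ^ n"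
  using lipschitz_onD[OF lipschitz_transition_funpow[OF assms], of x y n]
  by (simp add: dist_real_def mult_ac)

lemma lipschitz_corrector:
  assumes "L-lipschitz_on UNIV \<phi>"
  shows "(L / (1 - \<kappa>))-lipschitz_on UNIV (corrector \<phi> N)"
proof (rule lipschitz_onI)
  fix x y
  have "\<bar>corrector \<phi> N x - corrector \<phi> N y\<bar> = \<bar>\<Sum>n<N. (transition ^^ n) \<phi> x - (transition ^^ n) \<phi> y\<bar>"
    by (simp add: corrector_def sum_subtractf)
  also have "\<dots> \<le> (\<Sum>n<N. L * dist x y * \<kappa> ^ n)"
    using abs_transition_funpow_diff_le[OF assms] by (intro order_trans[OF sum_abs] sum_mono)
  also have "\<dots> = L * dist x y * (\<Sum>n<N. \<kappa> ^ n)"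
    by (simp add: sum_distrib_left)
  also have "\<dots> \<le> L * dist x y * (1 / (1 - \<kappa>))"
  proof (rule mult_left_mono)
    have "(\<Sum>n<N. \<kappa> ^ n) \<le> (\<Sum>n. \<kappa> ^ n)"
      using rate_nonneg rate_less_1 by (intro sum_le_suminf) auto
    then show "(\<Sum>n<N. \<kappa> ^ n) \<le> 1 / (1 - \<kappa>)"
      using rate_nonneg rate_less_1 by (simp add: suminf_geometric)
  qed (simp add: lipschitz_on_nonneg[OF assms])
  finally show "dist (corrector \<phi> N x) (corrector \<phi> N y) \<le> L / (1 - \<kappa>) * dist x y"
    by (simp add: dist_real_def)
qed (use lipschitz_on_nonneg[OF assms] rate_less_1 in simp)

lemma transition_corrector:
  assumes "L-lipschitz_on UNIV \<phi>"
  shows "\<phi> x + transition (corrector \<phi> N) x = corrector \<phi> N x + (transition ^^ N) \<phi> x"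
proof (induction N)
  case (Suc N)
  have corrector_Suc: "corrector \<phi> (Suc N) x
      = corrector \<phi> N x + (transition ^^ N) \<phi> x - (transition ^^ N) \<phi> z" for x
    by (simp add: corrector_def)
  have "transition (corrector \<phi> (Suc N)) x
      = transition (corrector \<phi> N) x + (transition ^^ Suc N) \<phi> x - (transition ^^ N) \<phi> z"
    using integrable_lipschitz[OF lipschitz_corrector[OF assms]]
      integrable_lipschitz[OF lipschitz_transition_funpow[OF assms]]
    by (simp add: transition_def corrector_Suc prob_space)
  with Suc show ?case using corrector_Suc[of x] by simp
qed (simp add: transition_def corrector_def)

lemma summable_transition_funpow_diff:
  assumes "L-lipschitz_on UNIV \<phi>"
  shows "summable (\<lambda>n. (transition ^^ n) \<phi> x - (transition ^^ n) \<phi> y)"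
proof (rule summable_comparison_test)
  show "summable (\<lambda>n. L * dist x y * \<kappa> ^ n)"
    using rate_nonneg rate_less_1 by (intro summable_mult summable_geometric) simp
  show "\<exists>N. \<forall>n\<ge>N. norm ((transition ^^ n) \<phi> x - (transition ^^ n) \<phi> y) \<le> L * dist x y * \<kappa> ^ n"
    using abs_transition_funpow_diff_le[OF assms] by simp
qed

lemma tendsto_transition_limit:
  assumes lip: "\<And>N. K-lipschitz_on UNIV (v N)" and base: "\<And>N. v N z = 0"
    and lim: "\<And>x. (\<lambda>N. v N x) \<longlonglongrightarrow> u x" and limit_lip: "K-lipschitz_on UNIV u"
  shows "(\<lambda>N. transition (v N) x) \<longlonglongrightarrow> transition u x"
  unfolding transition_def
proof (rule integral_dominated_convergence)
  show "integrable \<mu> (\<lambda>t. K * dist (F t x) z)"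
    using integrable_dist_map by simp
  show "AE t in \<mu>. norm (v N (F t x)) \<le> K * dist (F t x) z" for N
    using lipschitz_on_UNIV_abs_le[OF lip, of N _ z] by (simp add: base)
  show "AE t in \<mu>. (\<lambda>N. v N (F t x)) \<longlonglongrightarrow> u (F t x)"
    using lim by simp
qed (intro borel_measurable_integrable integrable_lipschitz[OF limit_lip] integrable_lipschitz[OF lip])+

theorem poisson_equation:
  assumes "L-lipschitz_on UNIV \<phi>"
  obtains u c K where "K-lipschitz_on UNIV u" "\<And>x. \<phi> x + transition u x = u x + c"
proof
  define u where "u x = (\<Sum>n. (transition ^^ n) \<phi> x - (transition ^^ n) \<phi> z)" for x
  define c where "c = \<phi> z + transition u z - u z"
  note corrector_lip = lipschitz_corrector[OF assms]
  have corrector_lim: "(\<lambda>N. corrector \<phi> N x) \<longlonglongrightarrow> u x" for x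
    using summable_LIMSEQ[OF summable_transition_funpow_diff[OF assms]]
    by (simp add: u_def corrector_def)
  show u_lip: "(L / (1 - \<kappa>))-lipschitz_on UNIV u"
  proof (rule lipschitz_onI)
    fix x y
    show "dist (u x) (u y) \<le> L / (1 - \<kappa>) * dist x y"
      using lipschitz_onD[OF corrector_lip, of x y]
      by (intro Lim_bounded[OF tendsto_dist[OF corrector_lim corrector_lim]]) auto
  qed (rule lipschitz_on_nonneg[OF corrector_lip])
  have "(\<lambda>N. \<phi> x + transition (corrector \<phi> N) x - corrector \<phi> N x)
      \<longlonglongrightarrow> \<phi> x + transition u x - u x" for x
    by (intro tendsto_intros corrector_lim tendsto_transition_limit[OF corrector_lip _ corrector_lim u_lip])
      (simp add: corrector_def)
  then have lim_funpow: "(\<lambda>N. (transition ^^ N) \<phi> x) \<longlonglongrightarrow> \<phi> x + transition u x - u x" for x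
    by (simp add: transition_corrector[OF assms])
  show "\<phi> x + transition u x = u x + c" for x
    using LIMSEQ_unique[OF tendsto_diff[OF lim_funpow[of x] lim_funpow[of z]]
        summable_LIMSEQ_zero[OF summable_transition_funpow_diff[OF assms]]]
    by (simp add: c_def)
qed

lemma borel_measurable_comp_iid_component:
  fixes G :: "'t \<Rightarrow> 'a \<Rightarrow> 'b::topological_space"
  assumes "(\<lambda>(t, x). G t x) \<in> borel_measurable (\<mu> \<Otimes>\<^sub>M borel)" "X \<in> borel_measurable (iid_sequences \<mu>)"
  shows "(\<lambda>h. G (h (Suc n)) (X h)) \<in> borel_measurable (iid_sequences \<mu>)"
proof -
  have "(\<lambda>h. (h (Suc n), X h)) \<in> iid_sequences \<mu> \<rightarrow>\<^sub>M \<mu> \<Otimes>\<^sub>M borel"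
    using assms(2) by measurable
  from measurable_compose[OF this assms(1)] show ?thesis by simp
qed

lemma borel_measurable_orbit [measurable]: "(\<lambda>h. orbit F h x n) \<in> borel_measurable (iid_sequences \<mu>)"
  by (induction n) (simp_all add: borel_measurable_comp_iid_component[OF measurable_map])

lemma dist_map_squared_le:
  "(dist (F t x) z)\<^sup>2 \<le> \<kappa> * (dist x z)\<^sup>2 + (dist (F t z) z)\<^sup>2 / (1 - \<kappa>)"
proof -
  define e where "e = dist (F t z) z / (1 - \<kappa>)"
  have "(dist (F t x) z)\<^sup>2 \<le> (\<kappa> * dist x z + (1 - \<kappa>) * e)\<^sup>2"
    using dist_map_le[of t x] rate_less_1 by (intro power_mono) (auto simp: e_def)
  also have "\<dots> = \<kappa> * (dist x z)\<^sup>2 + (1 - \<kappa>) * e\<^sup>2 - \<kappa> * (1 - \<kappa>) * (dist x z - e)\<^sup>2"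
    by (simp add: power2_eq_square algebra_simps)
  also have "\<dots> \<le> \<kappa> * (dist x z)\<^sup>2 + (1 - \<kappa>) * e\<^sup>2"
    using rate_nonneg rate_less_1 by simp
  finally show ?thesis
    using rate_less_1 by (simp add: e_def power2_eq_square)
qed

lemma L2_bounded_dist_orbit: "L2_bounded (iid_sequences \<mu>) (\<lambda>n h. dist (orbit F h x n) z)"
proof -
  interpret iid: prob_space "iid_sequences \<mu>" by (rule prob_space_iid_sequences)
  define V where "V = (\<integral>t. (dist (F t z) z)\<^sup>2 \<partial>\<mu>)"
  define C where "C = (dist x z)\<^sup>2 + V / (1 - \<kappa>)\<^sup>2"
  have "V / (1 - \<kappa>) = (1 - \<kappa>) * (V / (1 - \<kappa>)\<^sup>2)"
    using rate_less_1 by (simp add: power2_eq_square)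
  also have "\<dots> \<le> (1 - \<kappa>) * C"
    using rate_less_1 by (intro mult_left_mono) (auto simp: C_def)
  finally have C_invariant: "\<kappa> * C + V / (1 - \<kappa>) \<le> C" by (simp add: algebra_simps)
  have displacement: "integrable (iid_sequences \<mu>) (\<lambda>h. (dist (F (h (Suc n)) z) z)\<^sup>2)"
    "(\<integral>h. (dist (F (h (Suc n)) z) z)\<^sup>2 \<partial>iid_sequences \<mu>) = V" for n
    using integrable_iid_component_iff[of "\<lambda>t. (dist (F t z) z)\<^sup>2" n]
      integral_iid_component[of "\<lambda>t. (dist (F t z) z)\<^sup>2" n] square_integrable_displacement
    by (simp_all add: V_def)
  have "integrable (iid_sequences \<mu>) (\<lambda>h. (dist (orbit F h x n) z)\<^sup>2) \<and> (\<integral>h. (dist (orbit F h x n) z)\<^sup>2 \<partial>iid_sequences \<mu>) \<le> C" for n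
  proof (induction n)
    case 0
    show ?case by (simp add: C_def V_def iid.prob_space)
  next
    case (Suc n)
    let ?b = "\<lambda>h. \<kappa> * (dist (orbit F h x n) z)\<^sup>2 + (dist (F (h (Suc n)) z) z)\<^sup>2 / (1 - \<kappa>)"
    have bound_integrable: "integrable (iid_sequences \<mu>) ?b" using Suc displacement by simp
    have step_le: "(dist (orbit F h x (Suc n)) z)\<^sup>2 \<le> ?b h" for h
      using dist_map_squared_le by simp
    have step_integrable: "integrable (iid_sequences \<mu>) (\<lambda>h. (dist (orbit F h x (Suc n)) z)\<^sup>2)"
      by (rule Bochner_Integration.integrable_bound[OF bound_integrable])
        (use borel_measurable_orbit[of x "Suc n"] order_trans[OF step_le abs_ge_self] in \<open>auto simp del: orbit.simps\<close>)
    have "(\<integral>h. (dist (orbit F h x (Suc n)) z)\<^sup>2 \<partial>iid_sequences \<mu>) \<le> (\<integral>h. ?b h \<partial>iid_sequences \<mu>)"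
      using step_integrable bound_integrable step_le by (rule integral_mono)
    also have "\<dots> \<le> \<kappa> * C + V / (1 - \<kappa>)"
      using Suc displacement rate_nonneg by (simp add: mult_left_mono)
    finally show ?case using step_integrable C_invariant by simp
  qed
  then show ?thesis by (intro L2_boundedI[where C = C]) auto
qed

lemma L2_bounded_functional_orbit:
  fixes g :: "'t \<Rightarrow> 'a \<Rightarrow> real"
  assumes meas: "(\<lambda>(t, x). g t x) \<in> borel_measurable (\<mu> \<Otimes>\<^sub>M borel)"
    and lip: "\<And>t. L-lipschitz_on UNIV (g t)" and square: "integrable \<mu> (\<lambda>t. (g t z)\<^sup>2)"
  shows "L2_bounded (iid_sequences \<mu>) (\<lambda>n h. g (h (Suc n)) (orbit F h x n))"
proof (rule L2_bounded_dominated)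
  have "(\<lambda>t. g t z) \<in> borel_measurable \<mu>"
    using measurable_compose[OF measurable_Pair2'[of z borel \<mu>] meas] by simp
  then show "L2_bounded (iid_sequences \<mu>) (\<lambda>n h. \<bar>g (h (Suc n)) z\<bar> + L * dist (orbit F h x n) z)"
    using square by (intro L2_bounded_add L2_bounded_cmult L2_bounded_iid L2_bounded_dist_orbit) auto
  show "(\<lambda>h. g (h (Suc n)) (orbit F h x n)) \<in> borel_measurable (iid_sequences \<mu>)" for n
    by (rule borel_measurable_comp_iid_component[OF meas]) measurable
  show "\<bar>g (h (Suc n)) (orbit F h x n)\<bar> \<le> \<bar>\<bar>g (h (Suc n)) z\<bar> + L * dist (orbit F h x n) z\<bar>" for n h
    using lipschitz_on_UNIV_abs_le[OF lip] by (rule order_trans[OF _ abs_ge_self])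
qed

lemma L2_bounded_lipschitz_orbit:
  fixes \<phi> :: "'a \<Rightarrow> real"
  assumes "K-lipschitz_on UNIV \<phi>"
  shows "L2_bounded (iid_sequences \<mu>) (\<lambda>n h. \<phi> (orbit F h x n))"
  using lipschitz_on_UNIV_borel_measurable[OF assms]
  by (intro L2_bounded_functional_orbit[where g = "\<lambda>t. \<phi>" and L = K] assms) (auto simp: prob_space)

end

locale contracting_random_functional = contracting_random_map \<mu> F \<kappa> z
  for \<mu> :: "'t measure" and F :: "'t \<Rightarrow> 'a::metric_space \<Rightarrow> 'a" and \<kappa> z +
  fixes g :: "'t \<Rightarrow> 'a \<Rightarrow> real" and L :: real
  assumes measurable_functional: "(\<lambda>(t, x). g t x) \<in> borel_measurable (\<mu> \<Otimes>\<^sub>M borel)"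
    and lipschitz_functional: "\<And>t. L-lipschitz_on UNIV (g t)"
    and square_integrable_functional: "integrable \<mu> (\<lambda>t. (g t z)\<^sup>2)"
begin

definition mean_functional :: "'a \<Rightarrow> real" where
  "mean_functional x = (\<integral>t. g t x \<partial>\<mu>)"

definition solves_poisson :: "('a \<Rightarrow> real) \<Rightarrow> real \<Rightarrow> bool" where
  "solves_poisson u c \<longleftrightarrow>
    (\<exists>K. K-lipschitz_on UNIV u) \<and> (\<forall>x. mean_functional x + transition u x = u x + c)"

definition additive_functional :: "(nat \<Rightarrow> 't) \<Rightarrow> 'a \<Rightarrow> nat \<Rightarrow> real" where
  "additive_functional h x N = (\<Sum>n<N. g (h (Suc n)) (orbit F h x n))"

definition poisson_increment :: "('a \<Rightarrow> real) \<Rightarrow> real \<Rightarrow> 'a \<Rightarrow> nat \<Rightarrow> (nat \<Rightarrow> 't) \<Rightarrow> real" where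
  "poisson_increment u c x n h
    = g (h (Suc n)) (orbit F h x n) + u (orbit F h x (Suc n)) - u (orbit F h x n) - c"

lemma borel_measurable_functional [measurable]: "(\<lambda>t. g t x) \<in> borel_measurable \<mu>"
  using measurable_compose[OF measurable_Pair2'[of x borel \<mu>] measurable_functional] by simp

lemma integrable_functional: "integrable \<mu> (\<lambda>t. g t x)"
proof (rule Bochner_Integration.integrable_bound)
  have "integrable \<mu> (\<lambda>t. g t z)"
    by (rule square_integrable_imp_integrable[OF _ square_integrable_functional]) measurable
  then show "integrable \<mu> (\<lambda>t. \<bar>g t z\<bar> + L * dist x z)" by simp
  show "AE t in \<mu>. norm (g t x) \<le> norm (\<bar>g t z\<bar> + L * dist x z)"
    using lipschitz_on_UNIV_abs_le[OF lipschitz_functional] by (simp add: order_trans[OF _ abs_ge_self])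
qed measurable

lemma ex_poisson_solution: obtains u c where "solves_poisson u c"
proof -
  have "L-lipschitz_on UNIV mean_functional"
    unfolding mean_functional_def [abs_def]
    by (rule lipschitz_integral[OF lipschitz_functional integrable_functional])
  from poisson_equation[OF this] show thesis
    using that unfolding solves_poisson_def by metis
qed

lemma L2_bounded_poisson_increment:
  assumes "K-lipschitz_on UNIV u"
  shows "L2_bounded (iid_sequences \<mu>) (poisson_increment u c x)"
proof -
  interpret iid: prob_space "iid_sequences \<mu>" by (rule prob_space_iid_sequences)
  have u_orbit: "L2_bounded (iid_sequences \<mu>) (\<lambda>n h. u (orbit F h x n))"
    using assms by (rule L2_bounded_lipschitz_orbit)
  have g_orbit: "L2_bounded (iid_sequences \<mu>) (\<lambda>n h. g (h (Suc n)) (orbit F h x n))"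
    using measurable_functional lipschitz_functional square_integrable_functional
    by (rule L2_bounded_functional_orbit)
  have "L2_bounded (iid_sequences \<mu>) (\<lambda>n h. g (h (Suc n)) (orbit F h x n) + u (orbit F h x (Suc n))
      + - 1 * u (orbit F h x n) + - c)"
    by (intro L2_bounded_add L2_bounded_cmult iid.L2_bounded_const g_orbit u_orbit L2_bounded_reindex[OF u_orbit])
  then show ?thesis by (simp add: poisson_increment_def [abs_def])
qed

lemma integral_poisson_increment_fun_upd:
  assumes "solves_poisson u c"
  shows "(\<integral>t. poisson_increment u c x n (h(Suc n := t)) \<partial>\<mu>) = 0"
proof -
  obtain K where "K-lipschitz_on UNIV u"
    using assms unfolding solves_poisson_def by blast
  then have int_u: "integrable \<mu> (\<lambda>t. u (F t y))" for y
    by (rule integrable_lipschitz)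
  define y where "y = orbit F h x n"
  have "poisson_increment u c x n (h(Suc n := t)) = g t y + u (F t y) - (u y + c)" for t
    by (simp add: poisson_increment_def orbit_fun_upd y_def)
  then have "(\<integral>t. poisson_increment u c x n (h(Suc n := t)) \<partial>\<mu>)
      = mean_functional y + transition u y - (u y + c)"
    using int_u integrable_functional by (simp add: mean_functional_def transition_def prob_space)
  then show ?thesis
    using assms by (simp add: solves_poisson_def)
qed

lemma poisson_increments_orthogonal:
  assumes poisson: "solves_poisson u c" and "m \<noteq> n"
  shows "(\<integral>h. poisson_increment u c x m h * poisson_increment u c x n h \<partial>iid_sequences \<mu>) = 0"
  using \<open>m \<noteq> n\<close>
proof (induction m n rule: linorder_wlog)
  case (le m n)
  then have "m < n" by simp
  obtain K where "K-lipschitz_on UNIV u"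
    using poisson unfolding solves_poisson_def by blast
  from L2_bounded_poisson_increment[OF this]
  obtain C where increment: "\<And>k. poisson_increment u c x k \<in> borel_measurable (iid_sequences \<mu>)"
    "\<And>k. integrable (iid_sequences \<mu>) (\<lambda>h. (poisson_increment u c x k h)\<^sup>2)"
    by (rule L2_boundedE) blast
  have past: "poisson_increment u c x m (h(Suc n := t)) = poisson_increment u c x m h" for h t
    using \<open>m < n\<close> by (simp add: poisson_increment_def orbit_fun_upd)
  have "integrable (iid_sequences \<mu>) (\<lambda>h. poisson_increment u c x m h * poisson_increment u c x n h)"
    by (intro integrable_mult_if_squares_integrable increment)
  then show ?case
    unfolding iid_sequences_def
    by (subst integral_PiM_fun_upd[where i = "Suc n"])
      (simp_all add: past integral_poisson_increment_fun_upd[OF poisson] prob_space_axioms)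
qed (simp add: mult.commute)

lemma sum_poisson_increment:
  "(\<Sum>n<N. poisson_increment u c x n h)
    = additive_functional h x N + (u (orbit F h x N) - u x) - real N * c"
  by (induction N) (simp_all add: additive_functional_def poisson_increment_def algebra_simps)

theorem strong_law:
  assumes poisson: "solves_poisson u c"
  shows "AE h in iid_sequences \<mu>. (\<lambda>N. additive_functional h x N / real N) \<longlonglongrightarrow> c"
proof -
  obtain K where lip: "K-lipschitz_on UNIV u"
    using poisson unfolding solves_poisson_def by blast
  have "AE h in iid_sequences \<mu>. (\<lambda>N. u (orbit F h x N) / real N) \<longlonglongrightarrow> 0"
    by (rule AE_L2_bounded_div_tendsto_0[OF L2_bounded_lipschitz_orbit[OF lip]])
  moreover have "AE h in iid_sequences \<mu>. (\<lambda>N. (\<Sum>n<N. poisson_increment u c x n h) / real N) \<longlonglongrightarrow> 0"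
    by (intro AE_orthogonal_averages_tendsto_0 L2_bounded_poisson_increment[OF lip]
        poisson_increments_orthogonal[OF poisson])
  ultimately show ?thesis
  proof eventually_elim
    case (elim h)
    have "(\<lambda>N. u x / real N) \<longlonglongrightarrow> 0" by real_asymp
    with elim have "(\<lambda>N. (\<Sum>n<N. poisson_increment u c x n h) / real N
        - u (orbit F h x N) / real N + u x / real N + c) \<longlonglongrightarrow> 0 - 0 + 0 + c"
      by (intro tendsto_intros)
    moreover have "\<forall>\<^sub>F N in sequentially. (\<Sum>n<N. poisson_increment u c x n h) / real N
        - u (orbit F h x N) / real N + u x / real N + c = additive_functional h x N / real N"
      using eventually_gt_at_top[of 0]
      by eventually_elim (simp add: sum_poisson_increment field_simps)
    ultimately show ?case
      using Lim_transform_eventually by fastforce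
  qed
qed

end
section \<open>The softplus function\<close>

definition softplus :: "real \<Rightarrow> real" where
  "softplus y = ln (1 + exp y)"

lemma one_plus_exp_pos: "0 < 1 + exp (y::real)"
  by (simp add: add_pos_pos)

lemma exp_softplus: "exp (softplus y) = 1 + exp y"
  by (simp add: softplus_def one_plus_exp_pos)

lemma softplus_nonneg: "0 \<le> softplus y"
  by (simp add: softplus_def)

lemma softplus_mono: "x \<le> y \<Longrightarrow> softplus x \<le> softplus y"
  by (simp add: softplus_def one_plus_exp_pos)

lemma softplus_eq_ln_cosh: "softplus y = y / 2 + ln (2 * cosh (y / 2))"
proof -
  have "1 + exp y = exp (y / 2) * (2 * cosh (y / 2))"
    by (simp add: cosh_def algebra_simps flip: exp_add)
  then show ?thesis by (simp add: softplus_def ln_mult)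
qed

lemma softplus_uminus: "softplus (- y) = softplus y - y"
  by (simp add: softplus_eq_ln_cosh)

lemma one_plus_power_le:
  fixes x :: real
  assumes "0 \<le> x" "0 < n"
  shows "1 + x ^ n \<le> (1 + x) ^ n"
  using \<open>0 < n\<close>
proof (induction n rule: nat_induct_non_zero)
  case (Suc n)
  have "1 + x ^ Suc n \<le> (1 + x) * (1 + x ^ n)"
    using assms(1) by (simp add: algebra_simps)
  also have "\<dots> \<le> (1 + x) ^ Suc n"
    using Suc assms(1) by (simp add: mult_left_mono)
  finally show ?case .
qed simp

lemma softplus_le_exp_divide:
  assumes "0 < n"
  shows "softplus y \<le> real n * exp (y / real n)"
proof -
  define x where "x = exp (y / real n)"
  have x_props: "0 < x" "x ^ n = exp y"
    using assms by (simp_all add: x_def flip: exp_of_nat_mult)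
  have "1 + exp y \<le> (1 + x) ^ n"
    using one_plus_power_le[of x n] x_props assms by simp
  also have "\<dots> \<le> exp x ^ n"
    using x_props(1) exp_ge_add_one_self[of x] by (intro power_mono) auto
  also have "\<dots> = exp (real n * x)"
    by (simp add: exp_of_nat_mult)
  finally have "ln (1 + exp y) \<le> ln (exp (real n * x))"
    by (subst ln_le_cancel_iff) (auto simp: one_plus_exp_pos)
  then show ?thesis by (simp add: softplus_def x_def)
qed

lemma softplus_has_derivative [derivative_intros]:
  assumes "(f has_real_derivative f') (at x)"
  shows "((\<lambda>x. softplus (f x)) has_real_derivative (1 + tanh (f x / 2)) / 2 * f') (at x)"
proof -
  have "(softplus has_real_derivative exp y / (1 + exp y)) (at y)" for y
    unfolding softplus_def [abs_def]
    by (rule derivative_eq_intros refl | simp add: one_plus_exp_pos)+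
  moreover have "exp y / (1 + exp y) = (1 + tanh (y / 2)) / 2" for y :: real
    using one_plus_exp_pos[of "- y"] one_plus_exp_pos[of y]
    by (simp add: tanh_real_altdef exp_minus divide_simps)
  ultimately have "(softplus has_real_derivative (1 + tanh (f x / 2)) / 2) (at (f x))"
    by metis
  then show ?thesis by (rule DERIV_chain2[OF _ assms])
qed

lemma lipschitz_on_UNIV_if_derivative_bounded:
  fixes f :: "real \<Rightarrow> real"
  assumes "\<And>x. (f has_real_derivative f' x) (at x)" and bound: "\<And>x. \<bar>f' x\<bar> \<le> K"
  shows "K-lipschitz_on UNIV f"
proof (rule lipschitz_onI)
  fix x y :: real
  have "\<bar>f x - f y\<bar> \<le> K * \<bar>x - y\<bar>"
    by (rule field_differentiable_bound[of UNIV f f', simplified]) (use assms in auto)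
  then show "dist (f x) (f y) \<le> K * dist x y"
    by (simp add: dist_real_def)
qed (rule order_trans[OF abs_ge_zero bound])

lemma lipschitz_softplus: "1-lipschitz_on UNIV softplus"
proof (rule lipschitz_on_UNIV_if_derivative_bounded)
  show "(softplus has_real_derivative (1 + tanh (x / 2)) / 2 * 1) (at x)" for x
    by (rule softplus_has_derivative[OF DERIV_ident])
  show "\<bar>(1 + tanh (x / 2)) / 2 * 1\<bar> \<le> 1" for x :: real
    using tanh_real_bounds[of "x / 2"] by (simp add: abs_le_iff)
qed

lemma cosh_le_exp_abs: "cosh (x::real) \<le> exp \<bar>x\<bar>"
  by (auto simp: cosh_def abs_real_def)

lemma cosh_add_mult_cosh_diff: "cosh (x + y) * cosh (x - y) = (cosh x)\<^sup>2 + (sinh (y::real))\<^sup>2"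
proof -
  have "cosh (x + y) * cosh (x - y) = (cosh x)\<^sup>2 * (cosh y)\<^sup>2 - (sinh x)\<^sup>2 * (sinh y)\<^sup>2"
    by (simp add: cosh_add cosh_diff power2_eq_square algebra_simps)
  then show ?thesis
    by (simp add: cosh_square_eq algebra_simps)
qed

lemma softplus_second_difference:
  "softplus (x + t) + softplus (x - t) - 2 * softplus x = ln (1 + (sinh (t / 2))\<^sup>2 / (cosh (x / 2))\<^sup>2)"
proof -
  have "1 + (sinh (t / 2))\<^sup>2 / (cosh (x / 2))\<^sup>2 = cosh ((x + t) / 2) * cosh ((x - t) / 2) / (cosh (x / 2))\<^sup>2"
    using cosh_add_mult_cosh_diff[of "x / 2" "t / 2"]
    by (simp add: add_divide_distrib diff_divide_distrib)
  then show ?thesis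
    by (simp add: softplus_eq_ln_cosh ln_mult ln_div ln_realpow add_divide_distrib diff_divide_distrib)
qed

lemma softplus_second_difference_nonneg: "0 \<le> softplus (x + t) + softplus (x - t) - 2 * softplus x"
  unfolding softplus_second_difference by simp

lemma mult_ln_one_plus_le:
  fixes \<theta> s :: real
  assumes "0 \<le> \<theta>" "\<theta> \<le> 1" "0 \<le> s"
  shows "\<theta> * ln (1 + s) \<le> ln (1 + \<theta> * s)"
  using concave_onD[OF ln_concave, of "1 - \<theta>" "1 + s" 1] assms by (simp add: algebra_simps)

text \<open>The second difference of the softplus function at \<open>0\<close>.\<close>

definition convexity_gain :: "real \<Rightarrow> real" where
  "convexity_gain t = 2 * ln (cosh (t / 2))"

lemma convexity_gain_nonneg: "0 \<le> convexity_gain t"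
  using cosh_real_ge_1[of "t / 2"] by (simp add: convexity_gain_def)

lemma convexity_gain_eq_0_iff: "convexity_gain t = 0 \<longleftrightarrow> t = 0"
  by (simp add: convexity_gain_def)

lemma convexity_gain_le: "convexity_gain t \<le> \<bar>t\<bar>"
proof -
  have "ln (cosh (t / 2)) \<le> ln (exp \<bar>t / 2\<bar>)"
    using cosh_le_exp_abs[of "t / 2"] by (subst ln_le_cancel_iff) simp_all
  then show ?thesis by (simp add: convexity_gain_def)
qed

lemma softplus_second_difference_ge:
  assumes "x \<le> 0"
  shows "exp x * convexity_gain t \<le> softplus (x + t) + softplus (x - t) - 2 * softplus x"
proof -
  define s where "s = (sinh (t / 2))\<^sup>2"
  have "(cosh (x / 2))\<^sup>2 \<le> (exp \<bar>x / 2\<bar>)\<^sup>2"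
    by (intro power_mono cosh_le_exp_abs) simp
  also have "\<dots> = exp (- x)"
    using assms by (simp flip: exp_of_nat_mult)
  finally have cosh_le: "(cosh (x / 2))\<^sup>2 \<le> exp (- x)" .
  have "exp x * s = s / exp (- x)"
    by (simp add: exp_minus field_simps)
  also have "\<dots> \<le> s / (cosh (x / 2))\<^sup>2"
    using cosh_le by (rule divide_left_mono) (simp_all add: s_def)
  finally have sinh_cosh: "exp x * s \<le> s / (cosh (x / 2))\<^sup>2" .
  have "exp x * convexity_gain t = exp x * ln (1 + s)"
    using cosh_square_eq[of "t / 2"] ln_realpow[of "cosh (t / 2)" 2]
    by (simp add: convexity_gain_def s_def add.commute)
  also have "\<dots> \<le> ln (1 + exp x * s)"
    using assms by (intro mult_ln_one_plus_le) (auto simp: s_def)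
  also have "\<dots> \<le> ln (1 + s / (cosh (x / 2))\<^sup>2)"
    using sinh_cosh by (intro ln_mono) (auto simp: s_def add_pos_nonneg)
  finally show ?thesis
    unfolding softplus_second_difference s_def .
qed

section \<open>The recursion for the logarithm of the ratio of partition functions\<close>

definition overshoot :: "real \<Rightarrow> real \<Rightarrow> real" where
  "overshoot J x = softplus (x - 2 * J) - softplus (- x - 2 * J)"

definition ratio_map :: "real \<Rightarrow> real \<Rightarrow> real" where
  "ratio_map J x = x - overshoot J x"

definition growth :: "real \<Rightarrow> real \<Rightarrow> real" where
  "growth J x = softplus (x - 2 * J) + softplus (- x - 2 * J)"

text \<open>Only a fraction of \<open>\<bar>x\<bar> - 2 * J\<close> can stand in the exponent: below \<open>2 * J\<close> the product of the overshoot and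
  the distance of the ratio map to \<open>2 * J\<close> behaves like \<open>(2 * J - x) * exp (x - 2 * J)\<close>.\<close>

definition boundary_weight :: "real \<Rightarrow> real \<Rightarrow> real" where
  "boundary_weight J x = exp ((\<bar>x\<bar> - 2 * J) / 2)"

definition potential :: "real \<Rightarrow> real \<Rightarrow> real" where
  "potential J x = growth (J / 2) (x / 2)"

lemma overshoot_minus: "overshoot J (- x) = - overshoot J x"
  by (simp add: overshoot_def)

lemma ratio_map_minus: "ratio_map J (- x) = - ratio_map J x"
  by (simp add: ratio_map_def overshoot_minus)

lemma growth_minus: "growth J (- x) = growth J x"
  by (simp add: growth_def)

lemma growth_abs: "growth J \<bar>x\<bar> = growth J x"
  by (simp add: abs_real_def growth_minus)

lemma growth_nonneg: "0 \<le> growth J x"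
  by (simp add: growth_def softplus_nonneg)

lemma overshoot_nonneg: "0 \<le> x \<Longrightarrow> 0 \<le> overshoot J x"
  by (simp add: overshoot_def softplus_mono)

lemma overshoot_abs: "overshoot J \<bar>x\<bar> = \<bar>overshoot J x\<bar>"
  using overshoot_nonneg[of "\<bar>x\<bar>" J] by (auto simp: abs_real_def overshoot_minus split: if_splits)

lemma tanh_add_plus_tanh_diff_le:
  fixes a b :: real
  assumes "0 \<le> a"
  shows "tanh (a + b) + tanh (a - b) \<le> 2 * tanh a"
proof -
  define p q where "p = tanh a" and "q = tanh b"
  have p_bounds: "0 \<le> p" "p < 1" and "\<bar>q\<bar> < 1"
    using assms tanh_real_bounds[of a] tanh_real_bounds[of b] by (auto simp: p_def q_def)
  then have q_square: "q\<^sup>2 < 1" by (simp add: abs_square_less_1)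
  have "p\<^sup>2 * q\<^sup>2 \<le> 1 * q\<^sup>2"
    using p_bounds by (intro mult_right_mono) (auto simp: power_le_one)
  then have pq_bounds: "(p * q)\<^sup>2 \<le> q\<^sup>2" "\<bar>p * q\<bar> < 1"
    using q_square by (simp_all add: power_mult_distrib flip: abs_square_less_1)
  have "tanh (a + b) + tanh (a - b) = (p + q) / (1 + p * q) + (p - q) / (1 - p * q)"
    using tanh_add[of a b] tanh_add[of a "- b"] by (simp add: p_def q_def)
  also have "\<dots> = 2 * p * ((1 - q\<^sup>2) / (1 - (p * q)\<^sup>2))"
    using pq_bounds(2) by (subst add_frac_eq) (auto simp: power2_eq_square algebra_simps abs_less_iff)
  also have "\<dots> \<le> 2 * p * 1"
    using p_bounds pq_bounds q_square by (intro mult_left_mono) (simp_all add: divide_le_eq)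
  finally show ?thesis by (simp add: p_def)
qed

lemma ratio_map_has_derivative:
  "(ratio_map J has_real_derivative (tanh (J + x / 2) + tanh (J - x / 2)) / 2) (at x)"
proof -
  have deriv: "(ratio_map J has_real_derivative
      1 - ((1 + tanh ((x - 2 * J) / 2)) / 2 - (1 + tanh ((- x - 2 * J) / 2)) / 2 * - 1)) (at x)"
    unfolding ratio_map_def [abs_def] overshoot_def
    by (auto intro!: derivative_eq_intros)
  have tanh_reflect: "tanh ((x - 2 * J) / 2) = - tanh (J - x / 2)" "tanh ((- x - 2 * J) / 2) = - tanh (J + x / 2)"
    by (simp_all add: diff_divide_distrib flip: tanh_minus)
  show ?thesis
    by (rule DERIV_cong[OF deriv]) (unfold tanh_reflect, simp add: add_divide_distrib diff_divide_distrib)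
qed

lemma ratio_map_derivative_bounds:
  fixes J y :: real
  assumes "0 \<le> J"
  shows "0 \<le> (tanh (J + y) + tanh (J - y)) / 2" "(tanh (J + y) + tanh (J - y)) / 2 \<le> tanh J"
proof -
  have "tanh (- (J - y)) \<le> tanh (J + y)"
    using assms by (subst tanh_real_le_iff) simp
  then show "0 \<le> (tanh (J + y) + tanh (J - y)) / 2"
    unfolding tanh_minus by simp
  show "(tanh (J + y) + tanh (J - y)) / 2 \<le> tanh J"
    using tanh_add_plus_tanh_diff_le[OF assms, of y] by simp
qed

lemma lipschitz_ratio_map:
  assumes "0 \<le> J"
  shows "(tanh J)-lipschitz_on UNIV (ratio_map J)"
  using ratio_map_derivative_bounds[OF assms]
  by (intro lipschitz_on_UNIV_if_derivative_bounded[OF ratio_map_has_derivative]) simp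

lemma mono_ratio_map:
  assumes "0 \<le> J"
  shows "mono (ratio_map J)"
proof (rule monoI)
  fix x y :: real assume "x \<le> y"
  moreover have "\<exists>D. (ratio_map J has_real_derivative D) (at u) \<and> 0 \<le> D" for u
    using ratio_map_has_derivative ratio_map_derivative_bounds(1)[OF assms] by blast
  ultimately show "ratio_map J x \<le> ratio_map J y"
    by (rule DERIV_nonneg_imp_nondecreasing)
qed

lemma ratio_map_abs:
  assumes "0 \<le> J"
  shows "ratio_map J \<bar>x\<bar> = \<bar>ratio_map J x\<bar>"
proof -
  have "0 = ratio_map J 0" by (simp add: ratio_map_def overshoot_def)
  also have "\<dots> \<le> ratio_map J \<bar>x\<bar>" by (rule monoD[OF mono_ratio_map[OF assms]]) simp
  finally show ?thesis by (auto simp: abs_real_def ratio_map_minus split: if_splits)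
qed

lemma two_J_minus_ratio_map:
  "2 * J - ratio_map J x = softplus (2 * J - x) - softplus (- x - 2 * J)"
  using softplus_uminus[of "x - 2 * J"] by (simp add: ratio_map_def overshoot_def)

lemma abs_ratio_map_le:
  assumes "0 \<le> J"
  shows "\<bar>ratio_map J x\<bar> \<le> 2 * J"
proof -
  have "softplus (- \<bar>x\<bar> - 2 * J) \<le> softplus (2 * J - \<bar>x\<bar>)"
    using assms by (intro softplus_mono) simp
  then show ?thesis
    using two_J_minus_ratio_map[of J "\<bar>x\<bar>"] by (simp add: ratio_map_abs[OF assms])
qed

lemma lipschitz_growth: "2-lipschitz_on UNIV (growth J)"
proof (rule lipschitz_onI)
  fix x y :: real
  show "dist (growth J x) (growth J y) \<le> 2 * dist x y"
    using lipschitz_onD[OF lipschitz_softplus, of "x - 2 * J" "y - 2 * J"]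
      lipschitz_onD[OF lipschitz_softplus, of "- x - 2 * J" "- y - 2 * J"]
    unfolding dist_real_def growth_def by (smt (verit) UNIV_I)
qed simp

lemma lipschitz_potential: "1-lipschitz_on UNIV (potential J)"
proof (rule lipschitz_onI)
  fix x y :: real
  show "dist (potential J x) (potential J y) \<le> 1 * dist x y"
    using lipschitz_onD[OF lipschitz_growth, of "x / 2" "y / 2" "J / 2"]
    by (simp add: potential_def dist_real_def flip: diff_divide_distrib)
qed simp

lemma abs_overshoot_le_growth: "\<bar>overshoot J x\<bar> \<le> growth J x"
  using softplus_nonneg[of "x - 2 * J"] softplus_nonneg[of "- x - 2 * J"]
  by (simp add: overshoot_def growth_def)

lemma growth_le_abs_overshoot: "growth J x \<le> \<bar>overshoot J x\<bar> + 2 * exp (- 2 * J)"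
proof -
  have "softplus (- \<bar>x\<bar> - 2 * J) \<le> softplus (- 2 * J)"
    by (intro softplus_mono) simp
  also have "\<dots> \<le> exp (- 2 * J)"
    using softplus_le_exp_divide[of 1 "- 2 * J"] by simp
  finally have "growth J \<bar>x\<bar> \<le> overshoot J \<bar>x\<bar> + 2 * exp (- 2 * J)"
    by (simp add: growth_def overshoot_def)
  then show ?thesis by (simp add: growth_abs overshoot_abs)
qed

lemma abs_overshoot_le: "\<bar>overshoot J x\<bar> \<le> softplus (\<bar>x\<bar> - 2 * J)"
  unfolding overshoot_abs[symmetric]
  using softplus_nonneg[of "- \<bar>x\<bar> - 2 * J"] by (simp add: overshoot_def)

lemma two_J_minus_abs_ratio_map_le:
  assumes "0 \<le> J"
  shows "2 * J - \<bar>ratio_map J x\<bar> \<le> softplus (2 * J - \<bar>x\<bar>)"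
  using two_J_minus_ratio_map[of J "\<bar>x\<bar>"] softplus_nonneg[of "- \<bar>x\<bar> - 2 * J"]
  by (simp add: ratio_map_abs[OF assms])

lemma square_diff_ratio_map:
  assumes "0 \<le> J"
  shows "x\<^sup>2 - (ratio_map J x)\<^sup>2 = \<bar>overshoot J x\<bar> * (2 * \<bar>ratio_map J x\<bar> + \<bar>overshoot J x\<bar>)"
proof -
  have "\<bar>x\<bar> = \<bar>ratio_map J x\<bar> + \<bar>overshoot J x\<bar>"
    unfolding ratio_map_abs[OF assms, symmetric] overshoot_abs[symmetric] by (simp add: ratio_map_def)
  then have "\<bar>x\<bar>\<^sup>2 - \<bar>ratio_map J x\<bar>\<^sup>2 = \<bar>overshoot J x\<bar> * (2 * \<bar>ratio_map J x\<bar> + \<bar>overshoot J x\<bar>)"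
    by (simp only:) (simp add: power2_eq_square algebra_simps)
  then show ?thesis by (simp only: power2_abs)
qed

lemma square_diff_ratio_map_approx:
  assumes "0 \<le> J"
  shows "\<bar>x\<^sup>2 - (ratio_map J x)\<^sup>2 - 4 * J * \<bar>overshoot J x\<bar>\<bar> \<le> 16 * boundary_weight J x"
proof -
  define y r d where "y = \<bar>x\<bar> - 2 * J" and "r = \<bar>overshoot J x\<bar>" and "d = 2 * J - \<bar>ratio_map J x\<bar>"
  have weight: "boundary_weight J x = exp (y / 2)"
    by (simp add: boundary_weight_def y_def)
  have r_bounds: "0 \<le> r" "r \<le> softplus y" and d_bounds: "0 \<le> d" "d \<le> softplus (- y)"
    using abs_overshoot_le[of J x] abs_ratio_map_le[OF assms, of x] two_J_minus_abs_ratio_map_le[OF assms, of x]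
    by (simp_all add: r_def d_def y_def)
  have "x\<^sup>2 - (ratio_map J x)\<^sup>2 - 4 * J * r = r\<^sup>2 - 2 * (r * d)"
    using square_diff_ratio_map[OF assms, of x] by (simp add: r_def d_def power2_eq_square algebra_simps)
  moreover have "r\<^sup>2 \<le> 16 * exp (y / 2)"
  proof -
    have "r\<^sup>2 \<le> (4 * exp (y / 4))\<^sup>2"
      using r_bounds softplus_le_exp_divide[of 4 y] by (intro power_mono) auto
    then show ?thesis
      by (simp add: power_mult_distrib flip: exp_of_nat_mult)
  qed
  moreover have "r * d \<le> 2 * exp (y / 2)"
  proof -
    have "r * d \<le> exp y * (2 * exp (- y / 2))"
      using r_bounds d_bounds softplus_le_exp_divide[of 1 y] softplus_le_exp_divide[of 2 "- y"]
      by (intro mult_mono) auto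
    also have "\<dots> = 2 * exp (y + - y / 2)" by (subst exp_add) simp
    finally show ?thesis by simp
  qed
  moreover have "0 \<le> r * d" "0 \<le> r\<^sup>2" "0 \<le> exp (y / 2)" using r_bounds d_bounds by simp_all
  ultimately show ?thesis
    unfolding r_def[symmetric] weight abs_le_iff by linarith
qed

lemma growth_second_difference_ge:
  assumes "\<bar>x\<bar> \<le> 2 * J"
  shows "exp (\<bar>x\<bar> - 2 * J) * convexity_gain t \<le> growth J (x + t) + growth J (x - t) - 2 * growth J x"
proof -
  define y z where "y = x - 2 * J" and "z = - x - 2 * J"
  have "growth J (x + t) + growth J (x - t) - 2 * growth J x
    = (softplus (y + t) + softplus (y - t) - 2 * softplus y)
      + (softplus (z + t) + softplus (z - t) - 2 * softplus z)"
  proof -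
    have "x + t - 2 * J = y + t" "x - t - 2 * J = y - t" "- (x + t) - 2 * J = z - t" "- (x - t) - 2 * J = z + t"
      by (simp_all add: y_def z_def)
    then show ?thesis by (simp only: growth_def) (simp add: y_def z_def)
  qed
  moreover have "y \<le> 0" "z \<le> 0" "\<bar>x\<bar> - 2 * J = y \<or> \<bar>x\<bar> - 2 * J = z"
    using assms by (auto simp: y_def z_def)
  ultimately show ?thesis
    using softplus_second_difference_ge[of y t] softplus_second_difference_ge[of z t]
      softplus_second_difference_nonneg[of y t] softplus_second_difference_nonneg[of z t]
    by auto
qed

lemma potential_second_difference_ge:
  assumes "\<bar>x\<bar> \<le> 2 * J"
  shows "boundary_weight J x * convexity_gain t
           \<le> potential J (x + 2 * t) + potential J (x - 2 * t) - 2 * potential J x"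
  using growth_second_difference_ge[of "x / 2" "J / 2" t] assms
  by (simp add: potential_def boundary_weight_def add_divide_distrib diff_divide_distrib)

lemma potential_diff_ratio_map: "potential J x - potential J (ratio_map J x) \<le> \<bar>overshoot J x\<bar>"
  using lipschitz_onD[OF lipschitz_potential, of x "ratio_map J x" J]
  by (simp add: dist_real_def ratio_map_def)

lemma boundary_weight_shift: "boundary_weight J (x + 2 * t) \<le> boundary_weight J x * exp \<bar>t\<bar>"
proof -
  have "(\<bar>x + 2 * t\<bar> - 2 * J) / 2 \<le> (\<bar>x\<bar> - 2 * J) / 2 + \<bar>t\<bar>" by argo
  then show ?thesis by (simp add: boundary_weight_def flip: exp_add)
qed

section \<open>The transfer matrix\<close>

definition ising_weight :: "real \<Rightarrow> (nat \<Rightarrow> real) \<Rightarrow> nat \<Rightarrow> (nat \<Rightarrow> int) \<Rightarrow> real" where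
  "ising_weight J h N \<sigma> =
    exp (- 2 * J * (\<Sum>n=1..N. of_bool (\<sigma> n \<noteq> \<sigma> (n - 1))) + (\<Sum>n=1..N. of_int (\<sigma> n) * h n))"

lemma ising_Z_eq_sum_weight:
  "ising_Z N h a b J = (\<Sum>\<sigma> \<in> {\<sigma> \<in> {0..N} \<rightarrow>\<^sub>E {-1, 1}. \<sigma> 0 = a \<and> \<sigma> N = b}. ising_weight J h N \<sigma>)"
  unfolding ising_Z_def ising_weight_def ..

lemma ising_weight_Suc_fun_upd:
  "ising_weight J h (Suc N) (\<sigma>(Suc N := b))
    = ising_weight J h N \<sigma> * exp (- 2 * J * of_bool (b \<noteq> \<sigma> N) + of_int b * h (Suc N))"
proof -
  have "(\<Sum>n=1..N. of_bool ((\<sigma>(Suc N := b)) n \<noteq> (\<sigma>(Suc N := b)) (n - 1)) :: real)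
      = (\<Sum>n=1..N. of_bool (\<sigma> n \<noteq> \<sigma> (n - 1)))"
    by (intro sum.cong) auto
  moreover have "(\<Sum>n=1..N. of_int ((\<sigma>(Suc N := b)) n) * h n) = (\<Sum>n=1..N. of_int (\<sigma> n) * h n)"
    by (intro sum.cong) auto
  ultimately show ?thesis
    by (simp add: ising_weight_def distrib_left flip: exp_add)
qed

lemma spin_configurations_Suc:
  assumes "b \<in> {-1, 1}"
  shows "{\<sigma> \<in> {0..Suc N} \<rightarrow>\<^sub>E {-1, 1 :: int}. \<sigma> 0 = a \<and> \<sigma> (Suc N) = b}
    = (\<lambda>\<sigma>. \<sigma>(Suc N := b)) ` {\<sigma> \<in> {0..N} \<rightarrow>\<^sub>E {-1, 1}. \<sigma> 0 = a}"
  using assms unfolding atLeast0_atMost_Suc PiE_insert_eq by (auto simp: image_iff)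

lemma inj_on_fun_upd_PiE: "i \<notin> I \<Longrightarrow> inj_on (\<lambda>\<sigma>. \<sigma>(i := y)) (I \<rightarrow>\<^sub>E A)"
  by (rule inj_on_inverseI[where g = "\<lambda>\<sigma>. \<sigma>(i := undefined)"]) (metis PiE_arb fun_upd_triv fun_upd_upd)

lemma ising_Z_Suc:
  assumes b: "b \<in> {-1, 1}"
  shows "ising_Z (Suc N) h a b J =
    (\<Sum>c\<in>{-1, 1}. ising_Z N h a c J * exp (- 2 * J * of_bool (b \<noteq> c) + of_int b * h (Suc N)))"
proof -
  define S where "S = {\<sigma> \<in> {0..N} \<rightarrow>\<^sub>E {-1, 1 :: int}. \<sigma> 0 = a}"
  define step where "step c = exp (- 2 * J * of_bool (b \<noteq> c) + of_int b * h (Suc N))" for c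
  have finite_S: "finite S"
    unfolding S_def by (rule finite_subset[of _ "{0..N} \<rightarrow>\<^sub>E {-1, 1}"]) (auto intro: finite_PiE)
  have inj_upd: "inj_on (\<lambda>\<sigma>. \<sigma>(Suc N := b)) S"
    by (rule inj_on_subset[OF inj_on_fun_upd_PiE[of _ "{0..N}" _ "{-1, 1}"]]) (auto simp: S_def)
  have "ising_Z (Suc N) h a b J = (\<Sum>\<sigma>\<in>S. ising_weight J h (Suc N) (\<sigma>(Suc N := b)))"
    unfolding ising_Z_eq_sum_weight spin_configurations_Suc[OF b] S_def[symmetric]
    by (simp add: sum.reindex[OF inj_upd])
  also have "\<dots> = (\<Sum>\<sigma>\<in>S. ising_weight J h N \<sigma> * step (\<sigma> N))"
    by (simp add: ising_weight_Suc_fun_upd step_def)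
  also have "\<dots> = (\<Sum>c\<in>{-1, 1}. \<Sum>\<sigma> \<in> {\<sigma> \<in> S. \<sigma> N = c}. ising_weight J h N \<sigma> * step (\<sigma> N))"
    by (rule sum.group[symmetric, OF finite_S]) (auto simp: S_def PiE_iff)
  also have "\<dots> = (\<Sum>c\<in>{-1, 1}. ising_Z N h a c J * step c)"
    by (intro sum.cong refl)
      (simp add: ising_Z_eq_sum_weight S_def sum_distrib_right conj_assoc)
  finally show ?thesis by (simp only: step_def)
qed

lemma ising_Z_0:
  assumes a: "a \<in> {-1, 1}"
  shows "ising_Z 0 h a b J = of_bool (a = b)"
proof -
  have "{\<sigma> \<in> {0..0} \<rightarrow>\<^sub>E {-1, 1 :: int}. \<sigma> (0::nat) = a \<and> \<sigma> 0 = b} = (if a = b then {\<lambda>x\<in>{0}. a} else {})"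
    using a by (auto simp: PiE_iff extensional_def fun_eq_iff)
  then show ?thesis by (simp add: ising_Z_def)
qed

definition ising_step :: "real \<Rightarrow> real \<Rightarrow> real \<Rightarrow> real" where
  "ising_step J t x = ratio_map J (x + 2 * t)"

definition ising_growth :: "real \<Rightarrow> real \<Rightarrow> real \<Rightarrow> real" where
  "ising_growth J t x = growth J (x + 2 * t)"

lemma exp_half_growth_plus_ratio_map:
  "exp ((growth J x + ratio_map J x) / 2) = exp (x / 2) + exp (- x / 2 - 2 * J)"
proof -
  have "(growth J x + ratio_map J x) / 2 = x / 2 + softplus (- x - 2 * J)"
    by (simp add: growth_def ratio_map_def overshoot_def field_simps)
  then have "exp ((growth J x + ratio_map J x) / 2) = exp (x / 2) * (1 + exp (- x - 2 * J))"
    by (simp only: exp_add exp_softplus)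
  also have "\<dots> = exp (x / 2) + exp (x / 2 + (- x - 2 * J))"
    by (simp only: exp_add distrib_left mult_1_right)
  finally show ?thesis by simp
qed

text \<open>The starting points \<open>\<plusminus> 2 * J\<close> are the images of \<open>\<plusminus> \<infinity>\<close> under the ratio map: at \<open>N = 0\<close> one of the
  two partition functions vanishes.\<close>

lemma ising_Z_Suc_eq_exp:
  fixes h :: "nat \<Rightarrow> real" and J :: real
  assumes a: "a \<in> {-1, 1}" and b: "b \<in> {-1, 1}"
  defines "X \<equiv> orbit (ising_step J) h (2 * J * of_int a)"
  shows "ising_Z (Suc N) h a b J = exp ((- 2 * J + (\<Sum>n<N. ising_growth J (h (Suc n)) (X n))
    + of_int b * (X N + 2 * h (Suc N))) / 2)"
  using b
proof (induction N arbitrary: b)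
  case 0
  then show ?case
    using a by (subst ising_Z_Suc) (auto simp: ising_Z_0 X_def algebra_simps diff_divide_distrib)
next
  case (Suc N)
  define T l t where "T = (\<Sum>n<N. ising_growth J (h (Suc n)) (X n))"
    and "l = X N + 2 * h (Suc N)" and "t = h (Suc (Suc N))"
  have sign: "growth J (of_int b * l) = growth J l" "ratio_map J (of_int b * l) = of_int b * ratio_map J l"
    using Suc.prems by (auto simp: growth_minus ratio_map_minus)
  have IH: "ising_Z (Suc N) h a c J = exp ((- 2 * J + T + of_int c * l) / 2)" if "c \<in> {-1, 1}" for c
    using Suc.IH[OF that] by (simp add: T_def l_def)
  have "ising_Z (Suc (Suc N)) h a b J = exp ((- 2 * J + T) / 2 + of_int b * t)
      * (exp (of_int b * l / 2) + exp (- (of_int b * l) / 2 - 2 * J))"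
    using Suc.prems unfolding t_def
    by (subst ising_Z_Suc)
      (auto simp: IH distrib_left add_divide_distrib diff_divide_distrib algebra_simps simp flip: exp_add)
  also have "\<dots> = exp ((- 2 * J + T) / 2 + of_int b * t + (growth J l + of_int b * ratio_map J l) / 2)"
    unfolding exp_half_growth_plus_ratio_map[symmetric] sign exp_add[symmetric] ..
  also have "(- 2 * J + T) / 2 + of_int b * t + (growth J l + of_int b * ratio_map J l) / 2
      = (- 2 * J + (\<Sum>n<Suc N. ising_growth J (h (Suc n)) (X n)) + of_int b * (X (Suc N) + 2 * h (Suc (Suc N)))) / 2"
    by (simp add: T_def t_def l_def X_def ising_growth_def ising_step_def field_simps)
  finally show ?case .
qed

lemma tendsto_divide_Suc:
  fixes a :: "nat \<Rightarrow> real"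
  assumes "(\<lambda>n. a n / real n) \<longlonglongrightarrow> l"
  shows "(\<lambda>n. a n / real (Suc n)) \<longlonglongrightarrow> l"
proof -
  have "(\<lambda>n. a n / real n * (real n / real (Suc n))) \<longlonglongrightarrow> l * 1"
    by (rule tendsto_mult[OF assms]) real_asymp
  moreover have "\<forall>\<^sub>F n in sequentially. a n / real n * (real n / real (Suc n)) = a n / real (Suc n)"
    using eventually_gt_at_top[of 0] by eventually_elim simp
  ultimately show ?thesis
    using Lim_transform_eventually by fastforce
qed

lemma abs_orbit_ising_step_le:
  "0 \<le> J \<Longrightarrow> \<bar>x\<bar> \<le> 2 * J \<Longrightarrow> \<bar>orbit (ising_step J) h x n\<bar> \<le> 2 * J"
  by (cases n) (auto simp: ising_step_def abs_ratio_map_le)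

lemma ln_ising_Z_div_tendsto:
  assumes J: "0 \<le> J" and a: "a \<in> {-1, 1}" and b: "b \<in> {-1, 1}"
    and growth: "(\<lambda>N. (\<Sum>n<N. ising_growth J (h (Suc n)) (orbit (ising_step J) h (2 * J * of_int a) n)) / real N)
      \<longlonglongrightarrow> c"
    and noise: "(\<lambda>n. h (Suc n) / real n) \<longlonglongrightarrow> 0"
  shows "(\<lambda>N. ln (ising_Z N h a b J) / real N) \<longlonglongrightarrow> c / 2"
proof -
  define X where "X = orbit (ising_step J) h (2 * J * of_int a)"
  define G where "G N = (\<Sum>n<N. ising_growth J (h (Suc n)) (X n))" for N
  have X_limit: "(\<lambda>N. X N / real (Suc N)) \<longlonglongrightarrow> 0"
  proof (rule Lim_null_comparison)
    have "\<bar>X N\<bar> \<le> 2 * J" for N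
      unfolding X_def using a J by (intro abs_orbit_ising_step_le) auto
    then show "\<forall>\<^sub>F N in sequentially. norm (X N / real (Suc N)) \<le> 2 * J / real (Suc N)"
      by (simp add: divide_right_mono del: of_nat_Suc)
    show "(\<lambda>N. 2 * J / real (Suc N)) \<longlonglongrightarrow> 0" by real_asymp
  qed
  have const_limit: "(\<lambda>N. - 2 * J / real (Suc N)) \<longlonglongrightarrow> 0" by real_asymp
  have "(\<lambda>N. (- 2 * J / real (Suc N) + G N / real (Suc N)
      + of_int b * (X N / real (Suc N) + 2 * (h (Suc N) / real (Suc N)))) / 2)
      \<longlonglongrightarrow> (0 + c + of_int b * (0 + 2 * 0)) / 2"
    using growth noise unfolding X_def[symmetric] G_def[symmetric]
    by (intro tendsto_intros X_limit const_limit tendsto_divide_Suc) simp_all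
  moreover have "ln (ising_Z (Suc N) h a b J) / real (Suc N) = (- 2 * J / real (Suc N) + G N / real (Suc N)
      + of_int b * (X N / real (Suc N) + 2 * (h (Suc N) / real (Suc N)))) / 2" for N
    unfolding ising_Z_Suc_eq_exp[OF a b] X_def[symmetric] G_def[symmetric]
    by (simp add: add_divide_distrib diff_divide_distrib distrib_left mult.commute del: of_nat_Suc)
  ultimately have "(\<lambda>N. ln (ising_Z (Suc N) h a b J) / real (Suc N))
      \<longlonglongrightarrow> (0 + c + of_int b * (0 + 2 * 0)) / 2"
    by (simp only:)
  then have "(\<lambda>N. ln (ising_Z (Suc N) h a b J) / real (Suc N)) \<longlonglongrightarrow> c / 2" by simp
  then show ?thesis by (rule LIMSEQ_imp_Suc)
qed

section \<open>Existence of the free energy\<close>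

lemma free_energy_eqI:
  assumes prob: "prob_space \<mu>" and free_energy: "is_free_energy \<mu> J F"
  shows "free_energy \<mu> J = F"
  unfolding free_energy_def
proof (rule the_equality[of "is_free_energy \<mu> J", OF free_energy])
  fix F' assume "is_free_energy \<mu> J F'"
  interpret iid: prob_space "iid_sequences \<mu>"
    by (rule prob_space.prob_space_iid_sequences[OF prob])
  have "AE h in iid_sequences \<mu>. F' = F"
    using free_energy \<open>is_free_energy \<mu> J F'\<close> unfolding is_free_energy_def iid_sequences_def[symmetric]
    by eventually_elim (use LIMSEQ_unique in blast)
  then show "F' = F" by simp
qed

lemma borel_measurable_softplus [measurable]: "softplus \<in> borel_measurable borel"
  by (rule lipschitz_on_UNIV_borel_measurable[OF lipschitz_softplus])

lemma borel_measurable_overshoot [measurable]: "overshoot J \<in> borel_measurable borel"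
  unfolding overshoot_def [abs_def] by measurable

lemma borel_measurable_ratio_map [measurable]: "ratio_map J \<in> borel_measurable borel"
  unfolding ratio_map_def [abs_def] by measurable

lemma borel_measurable_growth [measurable]: "growth J \<in> borel_measurable borel"
  unfolding growth_def [abs_def] by measurable

lemma lipschitz_comp_translation:
  fixes \<phi> :: "real \<Rightarrow> real"
  shows "K-lipschitz_on UNIV \<phi> \<Longrightarrow> K-lipschitz_on UNIV (\<lambda>x. \<phi> (x + a))"
  unfolding lipschitz_on_def by (metis UNIV_I dist_add_cancel2)

locale square_integrable_noise = prob_space \<mu> for \<mu> :: "real measure" +
  assumes sets_eq [measurable_cong]: "sets \<mu> = sets borel"
    and integrable_square: "integrable \<mu> (\<lambda>t. t\<^sup>2)"
begin

lemma integrable_ident: "integrable \<mu> (\<lambda>t. t)"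
  by (rule square_integrable_imp_integrable[OF _ integrable_square]) measurable

lemma integrable_comp_affine:
  fixes \<phi> :: "real \<Rightarrow> real"
  assumes "K-lipschitz_on UNIV \<phi>"
  shows "integrable \<mu> (\<lambda>t. \<phi> (x + a * t))"
proof (rule Bochner_Integration.integrable_bound)
  show "integrable \<mu> (\<lambda>t. \<bar>\<phi> x\<bar> + K * (\<bar>a\<bar> * \<bar>t\<bar>))"
    using integrable_ident by simp
  note [measurable] = lipschitz_on_UNIV_borel_measurable[OF assms]
  show "(\<lambda>t. \<phi> (x + a * t)) \<in> borel_measurable \<mu>" by measurable
  have "\<bar>\<phi> (x + a * t)\<bar> \<le> \<bar>\<phi> x\<bar> + K * (\<bar>a\<bar> * \<bar>t\<bar>)" for t
    using lipschitz_on_UNIV_abs_le[OF assms, of "x + a * t" x] by (simp add: dist_real_def abs_mult)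
  then show "AE t in \<mu>. norm (\<phi> (x + a * t)) \<le> norm (\<bar>\<phi> x\<bar> + K * (\<bar>a\<bar> * \<bar>t\<bar>))"
    unfolding real_norm_def by (intro AE_I2 order_trans[OF _ abs_ge_self])
qed

lemma integrable_square_if_affinely_bounded:
  assumes [measurable]: "\<phi> \<in> borel_measurable borel"
    and bound: "\<And>t. \<bar>\<phi> t\<bar> \<le> a + b * \<bar>t\<bar>"
  shows "integrable \<mu> (\<lambda>t. (\<phi> t)\<^sup>2 :: real)"
proof (rule Bochner_Integration.integrable_bound)
  show "integrable \<mu> (\<lambda>t. 2 * a\<^sup>2 + 2 * b\<^sup>2 * t\<^sup>2)"
    using integrable_square by simp
  have "(\<phi> t)\<^sup>2 \<le> 2 * a\<^sup>2 + 2 * b\<^sup>2 * t\<^sup>2" for t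
  proof -
    have "(\<phi> t)\<^sup>2 \<le> (a + b * \<bar>t\<bar>)\<^sup>2"
      using power_mono[OF bound abs_ge_zero, of t 2] by simp
    also have "\<dots> \<le> 2 * a\<^sup>2 + 2 * b\<^sup>2 * t\<^sup>2"
      using sum_squares_bound[of a "b * \<bar>t\<bar>"] by (simp add: power2_sum power_mult_distrib)
    finally show ?thesis .
  qed
  then show "AE t in \<mu>. norm ((\<phi> t)\<^sup>2) \<le> norm (2 * a\<^sup>2 + 2 * b\<^sup>2 * t\<^sup>2)" by simp
qed measurable

end

locale ising_chain = square_integrable_noise +
  fixes J :: real
  assumes J_nonneg: "0 \<le> J"

sublocale ising_chain \<subseteq> contracting_random_functional \<mu> "ising_step J" "tanh J" 0 "ising_growth J" 2
proof
  show "(\<lambda>(t, x). ising_step J t x) \<in> borel_measurable (\<mu> \<Otimes>\<^sub>M borel)"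
    unfolding ising_step_def by measurable
  show "(\<lambda>(t, x). ising_growth J t x) \<in> borel_measurable (\<mu> \<Otimes>\<^sub>M borel)"
    unfolding ising_growth_def by measurable
  show "(tanh J)-lipschitz_on UNIV (ising_step J t)" for t
    unfolding ising_step_def [abs_def] by (rule lipschitz_comp_translation[OF lipschitz_ratio_map[OF J_nonneg]])
  show "2-lipschitz_on UNIV (ising_growth J t)" for t
    unfolding ising_growth_def [abs_def] by (rule lipschitz_comp_translation[OF lipschitz_growth])
  show "tanh J < 1" by (rule tanh_real_lt_1)
  show "integrable \<mu> (\<lambda>t. (dist (ising_step J t 0) 0)\<^sup>2)"
    unfolding ising_step_def
    by (rule integrable_square_if_affinely_bounded[where a = "2 * J" and b = 0])
      (simp_all add: abs_ratio_map_le[OF J_nonneg])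
  have "\<bar>growth J (0 + 2 * t)\<bar> \<le> growth J 0 + 4 * \<bar>t\<bar>" for t
    using lipschitz_onD[OF lipschitz_growth, of "2 * t" 0 J] growth_nonneg[of J 0]
    by (simp add: dist_real_def)
  then show "integrable \<mu> (\<lambda>t. (ising_growth J t 0)\<^sup>2)"
    unfolding ising_growth_def by (intro integrable_square_if_affinely_bounded) measurable
qed

context ising_chain
begin

lemma is_free_energy_half_growth_rate:
  assumes "solves_poisson u c"
  shows "is_free_energy \<mu> J (c / 2)"
proof -
  have "AE h in iid_sequences \<mu>. \<forall>a\<in>{-1, 1::int}.
      (\<lambda>N. additive_functional h (2 * J * of_int a) N / real N) \<longlonglongrightarrow> c"
    by (intro AE_finite_allI strong_law[OF assms]) auto
  moreover have "AE h in iid_sequences \<mu>. (\<lambda>n. h (Suc n) / real n) \<longlonglongrightarrow> 0"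
    by (intro AE_L2_bounded_div_tendsto_0 L2_bounded_iid[of "\<lambda>t. t"] integrable_square) measurable
  ultimately show ?thesis
    unfolding is_free_energy_def iid_sequences_def[symmetric]
  proof eventually_elim
    case (elim h)
    then show ?case
      unfolding additive_functional_def by (blast intro: ln_ising_Z_div_tendsto[OF J_nonneg])
  qed
qed

lemma free_energy_eq_half_growth_rate: "solves_poisson u c \<Longrightarrow> free_energy \<mu> J = c / 2"
  by (intro free_energy_eqI is_free_energy_half_growth_rate prob_space_axioms)

lemma ising_step_in_interval: "ising_step J t x \<in> {- 2 * J..2 * J}"
  using abs_ratio_map_le[OF J_nonneg, of "x + 2 * t"] by (auto simp: ising_step_def abs_le_iff)

lemma integrable_comp_step:
  fixes v :: "real \<Rightarrow> real"
  assumes "continuous_on UNIV v"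
  shows "integrable \<mu> (\<lambda>t. v (ising_step J t x))"
proof -
  have "compact (v ` {- 2 * J..2 * J})"
    by (intro compact_continuous_image continuous_on_subset[OF assms]) auto
  then obtain B where v_bound: "\<forall>y\<in>{- 2 * J..2 * J}. norm (v y) \<le> B"
    by (meson bounded_iff compact_imp_bounded imageI)
  have [measurable]: "v \<in> borel_measurable borel"
    using assms by (rule borel_measurable_continuous_onI)
  show ?thesis
    by (rule integrable_const_bound[of _ B]) (use v_bound ising_step_in_interval in \<open>auto intro!: AE_I2\<close>)
qed

text \<open>Coboundaries are disposed of by evaluating at a point where \<open>v - \<beta> * u\<close> is maximal.\<close>

lemma growth_rate_ge:
  assumes poisson: "solves_poisson u c" and v_cont: "continuous_on UNIV v"
    and drift: "\<And>x. \<bar>x\<bar> \<le> 2 * J \<Longrightarrow> a \<le> \<beta> * mean_functional x + transition v x - v x"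
  shows "a \<le> \<beta> * c"
proof -
  define w where "w x = v x - \<beta> * u x" for x
  have u_cont: "continuous_on UNIV u"
    using poisson lipschitz_on_continuous_on unfolding solves_poisson_def by blast
  then have w_cont: "continuous_on UNIV w"
    unfolding w_def by (intro continuous_intros v_cont)
  obtain x where x_mem: "x \<in> {- 2 * J..2 * J}" and maximal: "\<And>y. y \<in> {- 2 * J..2 * J} \<Longrightarrow> w y \<le> w x"
    using continuous_attains_sup[of "{- 2 * J..2 * J}" w] J_nonneg continuous_on_subset[OF w_cont] by force
  have "transition w x \<le> (\<integral>t. w x \<partial>\<mu>)"
    unfolding transition_def
    by (intro integral_mono integrable_comp_step[OF w_cont] maximal ising_step_in_interval) auto
  then have transition_le: "transition v x - \<beta> * transition u x \<le> v x - \<beta> * u x"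
    using integrable_comp_step[OF u_cont] integrable_comp_step[OF v_cont]
    by (simp add: transition_def w_def prob_space)
  have mean_functional_eq: "mean_functional x = u x + c - transition u x"
    using poisson by (simp add: solves_poisson_def algebra_simps)
  have "\<bar>x\<bar> \<le> 2 * J" using x_mem by (auto simp: abs_le_iff)
  from drift[OF this, unfolded mean_functional_eq] transition_le show ?thesis
    by (simp add: algebra_simps)
qed

end

section \<open>Bounds on the growth rate\<close>

locale symmetric_noise = prob_space \<mu> for \<mu> :: "real measure" +
  assumes sets_eq_borel: "sets \<mu> = sets borel"
    and symmetric: "distr \<mu> borel uminus = \<mu>"
    and exp_moment: "integrable \<mu> (\<lambda>t. exp \<bar>t\<bar>)"

sublocale symmetric_noise \<subseteq> square_integrable_noise
proof
  note [measurable_cong] = sets_eq_borel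
  show "integrable \<mu> (\<lambda>t. t\<^sup>2)"
  proof (rule Bochner_Integration.integrable_bound)
    show "integrable \<mu> (\<lambda>t. 2 * exp \<bar>t\<bar>)" using exp_moment by simp
    have "t\<^sup>2 \<le> 2 * exp \<bar>t\<bar>" for t :: real
      using exp_lower_Taylor_quadratic[OF abs_ge_zero, of t] abs_ge_zero[of t] unfolding power2_abs by argo
    then show "AE t in \<mu>. norm (t\<^sup>2) \<le> norm (2 * exp \<bar>t\<bar>)" by simp
  qed measurable
qed (rule sets_eq_borel)

context symmetric_noise
begin

definition mean_convexity_gain :: real where
  "mean_convexity_gain = expectation convexity_gain"

definition error_constant :: real where
  "error_constant = 32 * expectation (\<lambda>t. exp \<bar>t\<bar>) / mean_convexity_gain"

lemma expectation_uminus: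
  assumes "\<phi> \<in> borel_measurable borel"
  shows "expectation (\<lambda>t. \<phi> (- t)) = (expectation \<phi> :: real)"
  using integral_distr[of uminus \<mu> borel \<phi>] assms by (simp add: symmetric)

lemma integrable_uminus_iff:
  fixes \<phi> :: "real \<Rightarrow> real"
  assumes "\<phi> \<in> borel_measurable borel"
  shows "integrable \<mu> (\<lambda>t. \<phi> (- t)) \<longleftrightarrow> integrable \<mu> \<phi>"
  using integrable_distr_eq[of uminus \<mu> borel \<phi>] assms by (simp add: symmetric)

lemma expectation_ident: "expectation (\<lambda>t. t) = 0"
  using expectation_uminus[of "\<lambda>t. t"] by simp

lemma expectation_square: "expectation (\<lambda>t. t\<^sup>2) = variance (\<lambda>t. t)"
  by (simp add: expectation_ident)

lemma
  shows integrable_shifted_square: "integrable \<mu> (\<lambda>t. (x + 2 * t)\<^sup>2)"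
    and expectation_shifted_square: "expectation (\<lambda>t. (x + 2 * t)\<^sup>2) = x\<^sup>2 + 4 * variance (\<lambda>t. t)"
  by (simp_all add: power2_sum power_mult_distrib mult_ac integrable_square integrable_ident
      expectation_ident prob_space)

lemma integrable_convexity_gain: "integrable \<mu> convexity_gain"
proof (rule Bochner_Integration.integrable_bound)
  show "integrable \<mu> (\<lambda>t. \<bar>t\<bar>)" using integrable_ident by simp
  show "convexity_gain \<in> borel_measurable \<mu>"
    unfolding convexity_gain_def [abs_def] cosh_def by measurable
  show "AE t in \<mu>. norm (convexity_gain t) \<le> norm \<bar>t\<bar>"
    using convexity_gain_le convexity_gain_nonneg by simp
qed

lemma mean_convexity_gain_nonneg: "0 \<le> mean_convexity_gain"
  unfolding mean_convexity_gain_def by (simp add: convexity_gain_nonneg)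

lemma mean_convexity_gain_pos:
  assumes "0 < variance (\<lambda>t. t)"
  shows "0 < mean_convexity_gain"
proof (rule ccontr)
  assume "\<not> 0 < mean_convexity_gain"
  then have "expectation convexity_gain = 0"
    using mean_convexity_gain_nonneg by (simp add: mean_convexity_gain_def)
  then have "AE t in \<mu>. convexity_gain t = 0"
    by (subst (asm) integral_nonneg_eq_0_iff_AE) (auto simp: integrable_convexity_gain convexity_gain_nonneg)
  then have "expectation (\<lambda>t. t\<^sup>2) = 0"
    by (intro integral_eq_zero_AE) (simp add: convexity_gain_eq_0_iff)
  with assms show False by (simp add: expectation_square)
qed

lemma error_constant_nonneg: "0 \<le> error_constant"
  by (simp add: error_constant_def mean_convexity_gain_nonneg)

end

locale symmetric_ising_chain = symmetric_noise + ising_chain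
begin

definition mean_overshoot :: "real \<Rightarrow> real" where
  "mean_overshoot x = expectation (\<lambda>t. \<bar>overshoot J (x + 2 * t)\<bar>)"

lemma integrable_abs_overshoot: "integrable \<mu> (\<lambda>t. \<bar>overshoot J (x + 2 * t)\<bar>)"
  by (rule Bochner_Integration.integrable_bound[OF integrable_comp_affine[OF lipschitz_growth, of J x 2]])
    (auto simp: growth_nonneg abs_overshoot_le_growth)

lemma mean_overshoot_le_mean_functional: "mean_overshoot x \<le> mean_functional x"
  unfolding mean_overshoot_def mean_functional_def ising_growth_def
  by (intro integral_mono integrable_abs_overshoot integrable_comp_affine[OF lipschitz_growth]
      abs_overshoot_le_growth)

lemma mean_functional_le_mean_overshoot: "mean_functional x \<le> mean_overshoot x + 2 * exp (- 2 * J)"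
proof -
  have "mean_functional x \<le> expectation (\<lambda>t. \<bar>overshoot J (x + 2 * t)\<bar> + 2 * exp (- 2 * J))"
    unfolding mean_functional_def ising_growth_def
    by (intro integral_mono integrable_comp_affine[OF lipschitz_growth] growth_le_abs_overshoot
        Bochner_Integration.integrable_add integrable_abs_overshoot) simp
  then show ?thesis by (simp add: mean_overshoot_def integrable_abs_overshoot prob_space)
qed

lemma second_moment_drift_approx:
  "\<bar>x\<^sup>2 + 4 * variance (\<lambda>t. t) - transition (\<lambda>y. y\<^sup>2) x - 4 * J * mean_overshoot x\<bar>
    \<le> 16 * expectation (\<lambda>t. exp \<bar>t\<bar>) * boundary_weight J x"
proof -
  have square_integrable: "integrable \<mu> (\<lambda>t. (ising_step J t x)\<^sup>2)"
    by (intro integrable_comp_step[of "\<lambda>y. y\<^sup>2"] continuous_intros)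
  let ?error = "\<lambda>t. (x + 2 * t)\<^sup>2 - (ising_step J t x)\<^sup>2 - 4 * J * \<bar>overshoot J (x + 2 * t)\<bar>"
  have "\<bar>?error t\<bar> \<le> 16 * (boundary_weight J x * exp \<bar>t\<bar>)" for t
    using square_diff_ratio_map_approx[OF J_nonneg, of "x + 2 * t"] boundary_weight_shift[of J x t]
    unfolding ising_step_def by linarith
  then have "expectation (\<lambda>t. \<bar>?error t\<bar>) \<le> expectation (\<lambda>t. 16 * (boundary_weight J x * exp \<bar>t\<bar>))"
    by (intro integral_mono integrable_abs Bochner_Integration.integrable_diff integrable_mult_right
        integrable_shifted_square square_integrable integrable_abs_overshoot exp_moment)
  from order_trans[OF integral_abs_bound this]
  have "\<bar>expectation ?error\<bar> \<le> 16 * expectation (\<lambda>t. exp \<bar>t\<bar>) * boundary_weight J x"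
    by (simp add: mult_ac)
  then show ?thesis
    by (simp add: integrable_shifted_square expectation_shifted_square square_integrable integrable_abs_overshoot
      transition_def mean_overshoot_def)
qed

lemma expectation_potential_ge:
  assumes "\<bar>x\<bar> \<le> 2 * J"
  shows "potential J x + mean_convexity_gain / 2 * boundary_weight J x
    \<le> expectation (\<lambda>t. potential J (x + 2 * t))"
proof -
  note forward = integrable_comp_affine[OF lipschitz_potential, of J x]
  have [measurable]: "potential J \<in> borel_measurable borel"
    by (rule lipschitz_on_UNIV_borel_measurable[OF lipschitz_potential])
  have reflected: "integrable \<mu> (\<lambda>t. potential J (x - 2 * t))"
    "expectation (\<lambda>t. potential J (x - 2 * t)) = expectation (\<lambda>t. potential J (x + 2 * t))"
    using integrable_uminus_iff[of "\<lambda>t. potential J (x + 2 * t)"] forward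
      expectation_uminus[of "\<lambda>t. potential J (x + 2 * t)"] by simp_all
  have "expectation (\<lambda>t. boundary_weight J x * convexity_gain t)
      \<le> expectation (\<lambda>t. potential J (x + 2 * t) + potential J (x - 2 * t) - 2 * potential J x)"
    using potential_second_difference_ge[OF assms]
    by (intro integral_mono) (auto intro!: integrable_convexity_gain forward reflected(1))
  also have "\<dots> = 2 * expectation (\<lambda>t. potential J (x + 2 * t)) - 2 * potential J x"
    using forward reflected by (simp add: prob_space)
  finally show ?thesis
    by (simp add: mean_convexity_gain_def mult.commute)
qed

text \<open>The potential is strictly convex near \<open>\<plusminus> 2 * J\<close> on the scale of the noise, so the time that the
  recursion spends there is paid for by the overshoot.\<close>

lemma boundary_weight_le:
  assumes "\<bar>x\<bar> \<le> 2 * J"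
  shows "mean_convexity_gain / 2 * boundary_weight J x
    \<le> transition (potential J) x - potential J x + mean_overshoot x"
proof -
  have potential_integrable: "integrable \<mu> (\<lambda>t. potential J (ising_step J t x))"
    by (intro integrable_comp_step lipschitz_on_continuous_on[OF lipschitz_potential])
  have "potential J (x + 2 * t) \<le> potential J (ising_step J t x) + \<bar>overshoot J (x + 2 * t)\<bar>" for t
    using potential_diff_ratio_map[of J "x + 2 * t"] by (simp add: ising_step_def)
  then have "expectation (\<lambda>t. potential J (x + 2 * t))
      \<le> expectation (\<lambda>t. potential J (ising_step J t x) + \<bar>overshoot J (x + 2 * t)\<bar>)"
    by (intro integral_mono integrable_comp_affine[OF lipschitz_potential]
        Bochner_Integration.integrable_add potential_integrable integrable_abs_overshoot)
  also have "\<dots> = transition (potential J) x + mean_overshoot x"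
    by (simp add: potential_integrable integrable_abs_overshoot transition_def mean_overshoot_def)
  finally show ?thesis using expectation_potential_ge[OF assms] by linarith
qed

lemma second_moment_drift_le:
  assumes "0 < variance (\<lambda>t. t)" "\<bar>x\<bar> \<le> 2 * J"
  shows "\<bar>x\<^sup>2 + 4 * variance (\<lambda>t. t) - transition (\<lambda>y. y\<^sup>2) x - 4 * J * mean_overshoot x\<bar>
    \<le> error_constant * (transition (potential J) x - potential J x + mean_overshoot x)"
proof -
  have gain: "0 < mean_convexity_gain" by (rule mean_convexity_gain_pos[OF assms(1)])
  have "16 * expectation (\<lambda>t. exp \<bar>t\<bar>) * boundary_weight J x
      = error_constant * (mean_convexity_gain / 2 * boundary_weight J x)"
    using gain by (simp add: error_constant_def)
  also have "\<dots> \<le> error_constant * (transition (potential J) x - potential J x + mean_overshoot x)"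
    by (intro mult_left_mono boundary_weight_le assms error_constant_nonneg)
  finally show ?thesis
    using second_moment_drift_approx[of x] by linarith
qed

lemma transition_linear_combination:
  assumes "continuous_on UNIV v" "continuous_on UNIV w"
  shows "transition (\<lambda>y. \<alpha> * v y + \<beta> * w y) x = \<alpha> * transition v x + \<beta> * transition w x"
  using integrable_comp_step[OF assms(1)] integrable_comp_step[OF assms(2)] by (simp add: transition_def)

theorem growth_rate_bounds:
  assumes pos: "0 < variance (\<lambda>t. t)" and poisson: "solves_poisson u c"
  defines "B \<equiv> error_constant"
  shows "4 * variance (\<lambda>t. t) \<le> (4 * J + B) * c"
    and "B \<le> 4 * J \<Longrightarrow> (4 * J - B) * (c - 2 * exp (- 2 * J)) \<le> 4 * variance (\<lambda>t. t)"
proof -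
  have test_cont: "continuous_on UNIV (\<lambda>y::real. y\<^sup>2)" "continuous_on UNIV (potential J)"
    by (intro continuous_intros lipschitz_on_continuous_on[OF lipschitz_potential])+
  note drift = second_moment_drift_le[OF pos, folded B_def]
  have B_nonneg: "0 \<le> B" unfolding B_def by (rule error_constant_nonneg)
  show "4 * variance (\<lambda>t. t) \<le> (4 * J + B) * c"
  proof (rule growth_rate_ge[OF poisson, where v = "\<lambda>y. 1 * y\<^sup>2 + B * potential J y"])
    fix x assume "\<bar>x\<bar> \<le> 2 * J"
    have "(4 * J + B) * mean_overshoot x \<le> (4 * J + B) * mean_functional x"
      using B_nonneg J_nonneg by (intro mult_left_mono mean_overshoot_le_mean_functional) simp
    with abs_le_D1[OF drift[OF \<open>\<bar>x\<bar> \<le> 2 * J\<close>]]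
    show "4 * variance (\<lambda>t. t) \<le> (4 * J + B) * mean_functional x
        + transition (\<lambda>y. 1 * y\<^sup>2 + B * potential J y) x - (1 * x\<^sup>2 + B * potential J x)"
      unfolding transition_linear_combination[OF test_cont] by (simp add: algebra_simps)
  qed (intro continuous_intros test_cont)
  show "(4 * J - B) * (c - 2 * exp (- 2 * J)) \<le> 4 * variance (\<lambda>t. t)" if "B \<le> 4 * J"
  proof -
    have "- 4 * variance (\<lambda>t. t) - (4 * J - B) * (2 * exp (- 2 * J)) \<le> - (4 * J - B) * c"
    proof (rule growth_rate_ge[OF poisson, where v = "\<lambda>y. - 1 * y\<^sup>2 + B * potential J y"])
      fix x assume "\<bar>x\<bar> \<le> 2 * J"
      have "(4 * J - B) * mean_functional x \<le> (4 * J - B) * (mean_overshoot x + 2 * exp (- 2 * J))"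
        using that by (intro mult_left_mono mean_functional_le_mean_overshoot) simp
      with abs_le_D2[OF drift[OF \<open>\<bar>x\<bar> \<le> 2 * J\<close>]]
      show "- 4 * variance (\<lambda>t. t) - (4 * J - B) * (2 * exp (- 2 * J)) \<le> - (4 * J - B) * mean_functional x
          + transition (\<lambda>y. - 1 * y\<^sup>2 + B * potential J y) x - (- 1 * x\<^sup>2 + B * potential J x)"
        unfolding transition_linear_combination[OF test_cont] by (simp add: algebra_simps)
    qed (intro continuous_intros test_cont)
    then show ?thesis by (simp add: algebra_simps)
  qed
qed

corollary free_energy_bounds:
  assumes "0 < variance (\<lambda>t. t)"
  shows "2 * variance (\<lambda>t. t) \<le> (4 * J + error_constant) * free_energy \<mu> J"
    and "error_constant \<le> 4 * J \<Longrightarrow>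
      (4 * J - error_constant) * (free_energy \<mu> J - exp (- 2 * J)) \<le> 2 * variance (\<lambda>t. t)"
proof -
  obtain u c where poisson: "solves_poisson u c" by (rule ex_poisson_solution)
  have growth_rate: "c = 2 * free_energy \<mu> J"
    using free_energy_eq_half_growth_rate[OF poisson] by simp
  show "2 * variance (\<lambda>t. t) \<le> (4 * J + error_constant) * free_energy \<mu> J"
    using growth_rate_bounds(1)[OF assms poisson] by (simp add: growth_rate algebra_simps)
  show "(4 * J - error_constant) * (free_energy \<mu> J - exp (- 2 * J)) \<le> 2 * variance (\<lambda>t. t)"
    if "error_constant \<le> 4 * J"
    using growth_rate_bounds(2)[OF assms poisson that] by (simp add: growth_rate algebra_simps)
qed

end

theorem (in symmetric_noise) free_energy_asymptotics:
  assumes "0 < variance (\<lambda>t. t)"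
  shows "(\<lambda>J. free_energy \<mu> J - variance (\<lambda>t. t) / (2 * J)) \<in> O[at_top](\<lambda>J. 1 / J\<^sup>2)"
proof -
  define v B where "v = variance (\<lambda>t. t)" and "B = error_constant"
  define lower upper where "lower J = 2 * v / (4 * J + B) - v / (2 * J)"
    and "upper J = 2 * v / (4 * J - B) + exp (- 2 * J) - v / (2 * J)" for J
  have "\<forall>\<^sub>F J in at_top. norm (free_energy \<mu> J - v / (2 * J)) \<le> 1 * norm (\<bar>lower J\<bar> + \<bar>upper J\<bar>)"
    using eventually_gt_at_top[of B] eventually_gt_at_top[of 0]
  proof eventually_elim
    case (elim J)
    interpret symmetric_ising_chain \<mu> J
      by unfold_locales (use elim in simp)
    have "0 < 4 * J + B" "0 < 4 * J - B"
      using elim error_constant_nonneg by (simp_all add: B_def)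
    then have "2 * v / (4 * J + B) \<le> free_energy \<mu> J"
      "free_energy \<mu> J - exp (- 2 * J) \<le> 2 * v / (4 * J - B)"
      using free_energy_bounds[OF assms] by (simp_all add: v_def B_def pos_divide_le_eq pos_le_divide_eq mult.commute)
    then show ?case by (simp add: lower_def upper_def)
  qed
  then have "(\<lambda>J. free_energy \<mu> J - v / (2 * J)) \<in> O[at_top](\<lambda>J. \<bar>lower J\<bar> + \<bar>upper J\<bar>)"
    by (rule bigoI)
  also have "(\<lambda>J. \<bar>lower J\<bar> + \<bar>upper J\<bar>) \<in> O[at_top](\<lambda>J. 1 / J\<^sup>2)"
  proof (rule sum_in_bigo)
    show "(\<lambda>J. \<bar>lower J\<bar>) \<in> O[at_top](\<lambda>J. 1 / J\<^sup>2)"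
      unfolding lower_def landau_o.big.abs_in_iff by real_asymp
    show "(\<lambda>J. \<bar>upper J\<bar>) \<in> O[at_top](\<lambda>J. 1 / J\<^sup>2)"
      unfolding upper_def landau_o.big.abs_in_iff by real_asymp
  qed
  finally show ?thesis by (simp only: v_def)
qed

section \<open>Gaussian noise\<close>

lemma normal_density_times_exp:
  assumes "0 < \<sigma>"
  shows "normal_density m \<sigma> x * exp (s * x)
    = exp (s * m + s\<^sup>2 * \<sigma>\<^sup>2 / 2) * normal_density (m + s * \<sigma>\<^sup>2) \<sigma> x"
proof -
  have "- (x - m)\<^sup>2 / (2 * \<sigma>\<^sup>2) + s * x
      = s * m + s\<^sup>2 * \<sigma>\<^sup>2 / 2 + - (x - (m + s * \<sigma>\<^sup>2))\<^sup>2 / (2 * \<sigma>\<^sup>2)"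
    using assms by (simp add: field_simps power2_eq_square)
  then have "exp (- (x - m)\<^sup>2 / (2 * \<sigma>\<^sup>2)) * exp (s * x)
      = exp (s * m + s\<^sup>2 * \<sigma>\<^sup>2 / 2) * exp (- (x - (m + s * \<sigma>\<^sup>2))\<^sup>2 / (2 * \<sigma>\<^sup>2))"
    by (simp only: exp_add[symmetric])
  then show ?thesis by (simp add: normal_density_def)
qed

lemma integrable_normal_density_exp_abs:
  assumes "0 < \<sigma>"
  shows "integrable lborel (\<lambda>x. normal_density m \<sigma> x * exp (c * \<bar>x\<bar>))"
proof (rule Bochner_Integration.integrable_bound)
  have "integrable lborel (\<lambda>x. normal_density m \<sigma> x * exp (s * x))" for s
    unfolding normal_density_times_exp[OF assms] using assms by auto
  then show "integrable lborel (\<lambda>x. normal_density m \<sigma> x * exp (c * x) + normal_density m \<sigma> x * exp (- c * x))"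
    by (intro Bochner_Integration.integrable_add)
  have "exp (c * \<bar>x\<bar>) \<le> exp (c * x) + exp (- c * x)" for x :: real
    by (simp add: abs_real_def)
  then show "AE x in lborel. norm (normal_density m \<sigma> x * exp (c * \<bar>x\<bar>))
      \<le> norm (normal_density m \<sigma> x * exp (c * x) + normal_density m \<sigma> x * exp (- c * x))"
    by (simp add: mult_left_mono flip: distrib_left)
qed measurable

lemma centered_gaussian_eq_density:
  "0 < \<theta> \<Longrightarrow> centered_gaussian (\<theta>\<^sup>2) = density lborel (\<lambda>x. ennreal (normal_density 0 \<theta> x))"
  by (simp add: centered_gaussian_def)

lemma distributed_centered_gaussian:
  "0 < \<theta> \<Longrightarrow> distributed (centered_gaussian (\<theta>\<^sup>2)) lborel (\<lambda>x. x) (normal_density 0 \<theta>)"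
  unfolding distributed_def by (auto simp: centered_gaussian_eq_density distr_id2)

lemma prob_space_centered_gaussian: "0 < \<theta> \<Longrightarrow> prob_space (centered_gaussian (\<theta>\<^sup>2))"
  by (simp add: centered_gaussian_eq_density prob_space_normal_density)

lemma symmetric_noise_centered_gaussian:
  assumes "0 < \<theta>"
  shows "symmetric_noise (centered_gaussian (\<theta>\<^sup>2))"
proof -
  interpret prob_space "centered_gaussian (\<theta>\<^sup>2)"
    using assms by (rule prob_space_centered_gaussian)
  note density = centered_gaussian_eq_density[OF assms]
  show ?thesis
  proof
    show "sets (centered_gaussian (\<theta>\<^sup>2)) = sets borel" by (simp add: density)
    have "distr (centered_gaussian (\<theta>\<^sup>2)) borel uminus = distr (centered_gaussian (\<theta>\<^sup>2)) lborel uminus"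
      by (rule distr_cong) auto
    also have "\<dots> = centered_gaussian (\<theta>\<^sup>2)"
      using normal_density_affine[OF distributed_centered_gaussian[OF assms] assms, of "- 1" 0]
      by (simp add: distributed_def density)
    finally show "distr (centered_gaussian (\<theta>\<^sup>2)) borel uminus = centered_gaussian (\<theta>\<^sup>2)" .
    show "integrable (centered_gaussian (\<theta>\<^sup>2)) (\<lambda>t. exp \<bar>t\<bar>)"
      using integrable_normal_density_exp_abs[OF assms, of 0 1]
      unfolding density by (subst integrable_real_density) auto
  qed
qed

theorem theorem1:
  fixes \<theta> :: real
  assumes "\<theta> > 0"
  shows "(\<lambda>J. free_energy (centered_gaussian (\<theta>\<^sup>2)) J - \<theta>\<^sup>2 / (2 * J))
           \<in> O[at_top](\<lambda>J::real. sqrt (ln J) / J\<^sup>2)"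
proof -
  interpret symmetric_noise "centered_gaussian (\<theta>\<^sup>2)"
    using assms by (rule symmetric_noise_centered_gaussian)
  have "variance (\<lambda>t. t) = \<theta>\<^sup>2"
    by (rule normal_distributed_variance[OF assms distributed_centered_gaussian[OF assms]])
  then have "(\<lambda>J. free_energy (centered_gaussian (\<theta>\<^sup>2)) J - \<theta>\<^sup>2 / (2 * J)) \<in> O[at_top](\<lambda>J. 1 / J\<^sup>2)"
    using free_energy_asymptotics assms by simp
  also have "(\<lambda>J::real. 1 / J\<^sup>2) \<in> O[at_top](\<lambda>J. sqrt (ln J) / J\<^sup>2)"
    by real_asymp
  finally show ?thesis .
qed

end
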